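(* There exist a probability space $(\Omega,\mu)$, an invertible measure-preserving ergodic transformation $T:\Omega\to\Omega$, and a bounded measurable function $f:\Omega\to\mathbb{R}$ such that, with $H_\omega$ and $L(E)$ the associated Schrödinger operators and Lyapunov exponent, $L(E)=0$ for generic $E\in[-4,4]$ (that is, $\{E\in[-4,4]: L(E)=0\}$ contains a dense $G_\delta$ subset of $[-4,4]$), and furthermore, for every $\omega\in\Omega$, $[-4,4]\subseteq\sigma(H_\omega)$.
   Context: Given $(\Omega,\mu)$, $T$, $f$ as in the claim, for $\omega\in\Omega$ put $V_\omega(n)=f(T^n\omega)$, $n\in\mathbb{Z}$. $H_\omega=\Delta+V_\omega$ acts on $\ell^2(\mathbb{Z})$, where $(\Delta u)(n)=u(n+1)+u(n-1)$ and $V_\omega$ acts by multiplication; $\sigma(H_\omega)$ is its spectrum. The transfer matrices are $$A_N(E,V_\omega)=\prod_{n=1}^{N}\begin{pmatrix}E-V_\omega(N-n)&-1\\1&0\end{pmatrix}$$ (factors written left to right for $n=1,\dots,N$, so the rightmost factor involves $V_\omega(0)$). The Lyapunov exponent is $$L(E)=\lim_{N\to\infty}\frac1N\int_\Omega\log\|A_N(E,V_\omega)\|\,d\mu(\omega),\qquad E\in\mathbb{R}.$$ *)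

theory Defs
  imports "HOL-Probability.Probability"
begin

section \<open>Ergodic transformations\<close>

definition invertible_mpt :: "'a measure \<Rightarrow> ('a \<Rightarrow> 'a) \<Rightarrow> bool" where
  "invertible_mpt M T \<longleftrightarrow>
     bij_betw T (space M) (space M) \<and>
     T \<in> measurable M M \<and>
     the_inv_into (space M) T \<in> measurable M M \<and>
     distr M M T = M"

definition ergodic :: "'a measure \<Rightarrow> ('a \<Rightarrow> 'a) \<Rightarrow> bool" where
  "ergodic M T \<longleftrightarrow>
     (\<forall>A\<in>sets M. T -` A \<inter> space M = A \<longrightarrow> measure M A = 0 \<or> measure M A = 1)"

definition int_iterate :: "'a measure \<Rightarrow> ('a \<Rightarrow> 'a) \<Rightarrow> int \<Rightarrow> 'a \<Rightarrow> 'a" where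
  "int_iterate M T n =
     (if n \<ge> 0 then T ^^ nat n else the_inv_into (space M) T ^^ nat (- n))"

definition potential ::
    "'a measure \<Rightarrow> ('a \<Rightarrow> 'a) \<Rightarrow> ('a \<Rightarrow> real) \<Rightarrow> 'a \<Rightarrow> int \<Rightarrow> real" where
  "potential M T f \<omega> n = f (int_iterate M T n \<omega>)"

lemma int_iterate_add_one:
  assumes T: "bij_betw T (space M) (space M)" and \<omega>: "\<omega> \<in> space M"
  shows "int_iterate M T (n + 1) \<omega> = T (int_iterate M T n \<omega>)"
proof (cases "n \<ge> 0")
  case True
  then show ?thesis by (simp add: int_iterate_def nat_add_distrib)
next
  case False
  define S where "S = the_inv_into (space M) T"
  define k where "k = nat (- n - 1)"
  have n: "n = - int k - 1" using False by (simp add: k_def)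
  have S: "S x \<in> space M" "T (S x) = x" if "x \<in> space M" for x
    using that T bij_betwE[OF bij_betw_the_inv_into[OF T]] f_the_inv_into_f_bij_betw[OF T]
    by (auto simp: S_def)
  have mem: "(S ^^ j) \<omega> \<in> space M" for j
    by (induction j) (use \<omega> S in auto)
  have "int_iterate M T n \<omega> = S ((S ^^ k) \<omega>)"
    using n by (simp add: int_iterate_def S_def nat_add_distrib)
  moreover have "int_iterate M T (n + 1) \<omega> = (S ^^ k) \<omega>"
    using n by (cases "k = 0") (auto simp: int_iterate_def S_def)
  ultimately show ?thesis using S(2)[OF mem] by simp
qed


section \<open>The Hilbert space of square-summable sequences and spectra\<close>

text \<open>
  The space \<open>\<ell>\<^sup>2(\<int>)\<close> is represented as a set of functions, and an
  operator on it as a map on all sequences of which only the restriction to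
  \<open>ell2\<close> matters.
\<close>

definition ell2 :: "(int \<Rightarrow> complex) set" where
  "ell2 = {u. (\<lambda>n. (cmod (u n))\<^sup>2) summable_on UNIV}"

definition ell2_norm :: "(int \<Rightarrow> complex) \<Rightarrow> real" where
  "ell2_norm u = sqrt (\<Sum>\<^sub>\<infinity>n. (cmod (u n))\<^sup>2)"

definition ell2_bounded_linear :: "((int \<Rightarrow> complex) \<Rightarrow> int \<Rightarrow> complex) \<Rightarrow> bool" where
  "ell2_bounded_linear A \<longleftrightarrow>
     (\<forall>u\<in>ell2. A u \<in> ell2) \<and>
     (\<forall>u\<in>ell2. \<forall>v\<in>ell2. A (\<lambda>n. u n + v n) = (\<lambda>n. A u n + A v n)) \<and>
     (\<forall>c. \<forall>u\<in>ell2. A (\<lambda>n. c * u n) = (\<lambda>n. c * A u n)) \<and>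
     (\<exists>C. \<forall>u\<in>ell2. ell2_norm (A u) \<le> C * ell2_norm u)"

text \<open>For an operator that is bounded on \<open>\<ell>\<^sup>2(\<int>)\<close>.\<close>

definition ell2_spectrum :: "((int \<Rightarrow> complex) \<Rightarrow> int \<Rightarrow> complex) \<Rightarrow> complex set" where
  "ell2_spectrum A = {z. \<not> (\<exists>R. ell2_bounded_linear R \<and>
     (\<forall>u\<in>ell2. R (\<lambda>n. A u n - z * u n) = u) \<and>
     (\<forall>u\<in>ell2. (\<lambda>n. A (R u) n - z * R u n) = u))}"


section \<open>Schroedinger operators and Lyapunov exponents\<close>

definition schroedinger :: "(int \<Rightarrow> real) \<Rightarrow> (int \<Rightarrow> complex) \<Rightarrow> int \<Rightarrow> complex" where
  "schroedinger V u n = u (n + 1) + u (n - 1) + complex_of_real (V n) * u n"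

definition transfer_step :: "real \<Rightarrow> real \<Rightarrow> real^2^2" where
  "transfer_step E v = vector [vector [E - v, -1], vector [1, 0]]"

definition transfer_matrix :: "real \<Rightarrow> (int \<Rightarrow> real) \<Rightarrow> nat \<Rightarrow> real^2^2" where
  "transfer_matrix E V N =
     foldr (\<lambda>n B. transfer_step E (V (int N - int n)) ** B) [1..<N + 1] (mat 1)"

lemma transfer_matrix_0: "transfer_matrix E V 0 = mat 1"
  by (simp add: transfer_matrix_def)

lemma transfer_matrix_Suc:
  "transfer_matrix E V (Suc N) = transfer_step E (V (int N)) ** transfer_matrix E V N"
proof -
  have "[1..<Suc N + 1] = 1 # map Suc [1..<N + 1]"
    by (subst upt_conv_Cons) (simp_all only: map_Suc_upt, simp_all)
  then show ?thesis
    by (simp add: transfer_matrix_def foldr_map o_def del: upt_Suc)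
qed

text \<open>
  The matrix norm is the Euclidean operator norm.  For bounded measurable \<open>f\<close> and
  measure-preserving \<open>T\<close> on a probability space the integrands are bounded and measurable,
  and the limit exists by subadditivity.
\<close>

definition lyapunov ::
    "'a measure \<Rightarrow> ('a \<Rightarrow> 'a) \<Rightarrow> ('a \<Rightarrow> real) \<Rightarrow> real \<Rightarrow> real" where
  "lyapunov M T f E =
     lim (\<lambda>N. 1 / real N *
       (\<integral>\<omega>. ln (onorm ((*v) (transfer_matrix E (potential M T f \<omega>) N))) \<partial>M))"


lemma ell2_shift: "u \<in> ell2 \<Longrightarrow> (\<lambda>n. u (n + k)) \<in> ell2"
proof -
  assume "u \<in> ell2"
  moreover have "bij (\<lambda>n::int. n + k)"
    by (rule bij_betw_byWitness[where f' = "\<lambda>n. n - k"]) auto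
  ultimately show ?thesis
    using summable_on_reindex_bij_betw[of "\<lambda>n. n + k" UNIV UNIV "\<lambda>n. (cmod (u n))\<^sup>2"]
    by (simp add: ell2_def)
qed

lemma ell2_add:
  assumes "u \<in> ell2" "v \<in> ell2"
  shows "(\<lambda>n. u n + v n) \<in> ell2"
proof -
  have "(\<lambda>n. 2 * ((cmod (u n))\<^sup>2 + (cmod (v n))\<^sup>2)) summable_on UNIV"
    using assms by (intro summable_on_cmult_right summable_on_add) (auto simp: ell2_def)
  moreover have "(cmod (u n + v n))\<^sup>2 \<le> 2 * ((cmod (u n))\<^sup>2 + (cmod (v n))\<^sup>2)" for n
  proof -
    have "(cmod (u n + v n))\<^sup>2 \<le> (cmod (u n) + cmod (v n))\<^sup>2"
      by (intro power_mono norm_triangle_ineq) auto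
    also have "\<dots> \<le> 2 * ((cmod (u n))\<^sup>2 + (cmod (v n))\<^sup>2)"
      using sum_squares_bound[of "cmod (u n)" "cmod (v n)"] by (simp add: power2_sum)
    finally show ?thesis .
  qed
  ultimately show ?thesis
    unfolding ell2_def mem_Collect_eq
    by (rule summable_on_comparison_test) auto
qed

lemma schroedinger_in_ell2:
  assumes u: "u \<in> ell2" and V: "\<And>n. \<bar>V n\<bar> \<le> C"
  shows "schroedinger V u \<in> ell2"
proof -
  have "(\<lambda>n. C\<^sup>2 * (cmod (u n))\<^sup>2) summable_on UNIV"
    using u by (intro summable_on_cmult_right) (auto simp: ell2_def)
  then have "(\<lambda>n. (cmod (complex_of_real (V n) * u n))\<^sup>2) summable_on UNIV"
  proof (rule summable_on_comparison_test)
    fix n :: int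
    have "(V n)\<^sup>2 \<le> C\<^sup>2" using V[of n] by (simp add: abs_le_square_iff[symmetric])
    then show "(cmod (complex_of_real (V n) * u n))\<^sup>2 \<le> C\<^sup>2 * (cmod (u n))\<^sup>2"
      by (simp add: norm_mult power_mult_distrib mult_right_mono)
  qed auto
  then have "(\<lambda>n. complex_of_real (V n) * u n) \<in> ell2" by (simp add: ell2_def)
  then have "(\<lambda>n. (u (n + 1) + u (n + - 1)) + complex_of_real (V n) * u n) \<in> ell2"
    by (intro ell2_add ell2_shift u)
  then show ?thesis by (simp add: schroedinger_def[abs_def])
qed

end

theory Submission
  imports Defs
begin

text \<open>
  The potential takes the values \<open>2\<close> and \<open>-2\<close> and contains arbitrarily long constant runs of both
  values along almost every orbit; truncated plane waves on these runs give \<open>[-4,4]\<close> in the spectrum.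
  It is a limit of potentials \<open>v k\<close> sampled along the dyadic odometer with periods \<open>2 ^ s k\<close>, where
  \<open>v (k + 1)\<close> differs from \<open>v k\<close> only by one run of each value per period \<open>2 ^ s (k + 1)\<close>.
  The same truncated plane waves show that the energies with a nonzero periodic solution for \<open>v k\<close>
  are \<open>5 / sqrt k\<close>-dense in \<open>[-4,4]\<close>, and at such energies the transfer matrices grow linearly.
  Choosing \<open>s (k + 1)\<close> large after a scale \<open>N k\<close> at which this growth is already subexponential, the
  growth is inherited by the limit potential up to an error \<open>O(1 / k)\<close>, on an open set of energies.
  The energies lying in infinitely many of these open sets form the required dense \<open>G\<^sub>\<delta>\<close>.
\<close>

section \<open>Periodic potentials\<close>

text \<open>A constant potential c has spectrum [c - 2, c + 2]; the values 2 and -2 are chosen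
  because [0,4] and [-4,0] together fill [-4,4]. At an energy with a nonzero periodic solution the
  monodromy matrix fixes a vector and has determinant one, so it is unipotent and its powers grow
  linearly. The difficulty is to pass this to the limit, since vanishing of L at an energy is not
  stable under changes of the potential. What survives is a strict bound on the norm at one finite
  scale. It is demanded at every phase, because a point of the odometer may see the periodic
  potential from any phase, and compactness of [-4,4] leaves finitely many energies, so that one
  scale serves all of them. Later changes hit a window of that scale with small probability, and on
  this exceptional set the trivial factor 8 per step is good enough. The runs are present only
  almost surely, whereas the spectral claim concerns every point; so the base space is finally cut
  down to an invariant set of full measure, on which the odometer axioms hold again.\<close>

definition periodic :: "int \<Rightarrow> (int \<Rightarrow> 'a) \<Rightarrow> bool" where
  "periodic q u \<longleftrightarrow> (\<forall>n. u (n + q) = u n)"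

lemma periodic_mult: "periodic q u \<Longrightarrow> u (n + q * k) = u n"
proof (induction k rule: int_induct[where k = 0])
  case (step1 k)
  have "u (n + q * (k + 1)) = u ((n + q * k) + q)" by (simp add: algebra_simps)
  then show ?case using step1 by (simp add: periodic_def)
next
  case (step2 k)
  have "u (n + q * (k - 1) + q) = u (n + q * k)" by (simp add: algebra_simps)
  then show ?case using step2 by (simp add: periodic_def)
qed simp

lemma periodic_mod: "periodic q u \<Longrightarrow> u (n mod q) = u n"
  using periodic_mult[of q u "n mod q" "n div q"] by (simp add: add.commute)

lemma periodic_dvd: "periodic q u \<Longrightarrow> q dvd q' \<Longrightarrow> periodic q' u"
  by (auto simp: periodic_def[of q'] periodic_mult elim!: dvdE)

lemma periodic_shift: "periodic q u \<Longrightarrow> periodic q (\<lambda>n. u (n + j))"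
  unfolding periodic_def by (metis add.assoc add.commute)

lemma periodic_sum:
  fixes g :: "int \<Rightarrow> 'a::ab_group_add"
  assumes "periodic q g" "q > 0"
  shows "sum g {a..<a + q} = sum g {0..<q}"
proof -
  have step: "sum g {a + 1..<a + 1 + q} = sum g {a..<a + q}" for a
  proof -
    have 1: "{a..<a + q} = insert a {a + 1..<a + q}"
      and 2: "{a + 1..<a + 1 + q} = insert (a + q) {a + 1..<a + q}"
      using \<open>q > 0\<close> by auto
    have "sum g {a..<a + q} = g a + sum g {a + 1..<a + q}" by (subst 1) simp
    moreover have "sum g {a + 1..<a + 1 + q} = g (a + q) + sum g {a + 1..<a + q}"
      by (subst 2) simp
    moreover have "g (a + q) = g a" using assms(1) by (simp add: periodic_def)
    ultimately show ?thesis by simp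
  qed
  show ?thesis
  proof (induction a rule: int_induct[where k = 0])
    case (step1 i) then show ?case using step[of i] by simp
  next
    case (step2 i) then show ?case using step[of "i - 1"] by simp
  qed simp
qed

lemma periodic_sum_translate:
  fixes g :: "int \<Rightarrow> 'a::ab_group_add"
  assumes "periodic q g" "q > 0"
  shows "(\<Sum>n\<in>{0..<q}. g (n + k)) = sum g {0..<q}"
proof -
  have "bij_betw (\<lambda>n. n + k) {0..<q} {k..<k + q}"
    by (rule bij_betw_byWitness[where f' = "\<lambda>n. n - k"]) auto
  then have "(\<Sum>n\<in>{0..<q}. g (n + k)) = sum g {k..<k + q}"
    by (rule sum.reindex_bij_betw)
  then show ?thesis using periodic_sum[OF assms] by simp
qed

section \<open>Periodic eigenvalues by minimisation\<close>

definition residual :: "(int \<Rightarrow> real) \<Rightarrow> real \<Rightarrow> (int \<Rightarrow> real) \<Rightarrow> int \<Rightarrow> real" where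
  "residual V E u n = u (n + 1) + u (n - 1) + (V n - E) * u n"

lemma residual_periodic:
  assumes "periodic q V" "periodic q u" shows "periodic q (residual V E u)"
proof -
  have "u (n + q + 1) = u (n + 1)" "u (n + q - 1) = u (n - 1)" for n
    using assms(2)[unfolded periodic_def, rule_format, of "n + 1"]
      assms(2)[unfolded periodic_def, rule_format, of "n - 1"] by (simp_all add: algebra_simps)
  then show ?thesis using assms by (simp add: periodic_def residual_def)
qed

lemma residual_lincomb:
  "residual V E (\<lambda>n. u n + t * w n) n = residual V E u n + t * residual V E w n"
  by (simp add: residual_def algebra_simps)

lemma residual_scale: "residual V E (\<lambda>n. t * w n) n = t * residual V E w n"
  by (simp add: residual_def algebra_simps)

text \<open>Summation by parts without boundary terms, because a sum over a full period does not
  depend on where it starts.\<close>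

lemma residual_symmetric:
  assumes "q > 0" "periodic q V" "periodic q u" "periodic q w"
  shows "(\<Sum>n\<in>{0..<q}. residual V E u n * w n) = (\<Sum>n\<in>{0..<q}. u n * residual V E w n)"
proof -
  have p1: "periodic q (\<lambda>n. u (n + 1) * w n)" and p2: "periodic q (\<lambda>n. u n * w (n + 1))"
    using periodic_shift[OF assms(3), of 1] periodic_shift[OF assms(4), of 1] assms(3,4)
    by (simp_all add: periodic_def)
  have "(\<Sum>n\<in>{0..<q}. u (n + 1) * w n) = (\<Sum>n\<in>{0..<q}. u n * w (n - 1))"
    using periodic_sum_translate[OF p1 assms(1), of "-1"] by simp
  moreover have "(\<Sum>n\<in>{0..<q}. u n * w (n + 1)) = (\<Sum>n\<in>{0..<q}. u (n - 1) * w n)"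
    using periodic_sum_translate[OF p2 assms(1), of "-1"] by simp
  ultimately show ?thesis
    by (simp add: residual_def algebra_simps sum.distrib sum_subtractf)
qed

text \<open>First-order condition for the minimisation below. At t = - b / A with A > \<bar>a\<bar>
  the linear gain \<open>b\<^sup>2 / A\<close> outweighs the quadratic term.\<close>

lemma quadratic_nonneg_linear_coeff_zero:
  fixes a b :: real
  assumes "\<And>t. 0 \<le> t * b + t\<^sup>2 * a"
  shows "b = 0"
proof (rule ccontr)
  assume "b \<noteq> 0"
  define A where "A = \<bar>a\<bar> + 1"
  have "A > 0" "a < A" by (auto simp: A_def)
  have "0 \<le> (- b / A) * b + (- b / A)\<^sup>2 * a" by (rule assms)
  also have "\<dots> = (b\<^sup>2 / A) * (a / A - 1)"
    using \<open>A > 0\<close> by (simp add: power2_eq_square field_simps)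
  also have "\<dots> < 0"
    using \<open>b \<noteq> 0\<close> \<open>A > 0\<close> \<open>a < A\<close> by (intro mult_pos_neg) auto
  finally show False by simp
qed

text \<open>
  A unit vector minimising the norm of \<open>(H - E) u\<close> is an eigenvector of
  \<open>(H - E)\<^sup>2\<close>, and \<open>(H - E)\<^sup>2 - l\<^sup>2\<close> factorises.
\<close>

lemma periodic_eigenvalue_near:
  fixes E c :: real
  assumes q: "q > 0" and V: "periodic q V" and u0: "periodic q u0" "u0 m \<noteq> 0" and c: "c \<ge> 0"
    and le: "(\<Sum>n\<in>{0..<q}. (residual V E u0 n)\<^sup>2) \<le> c\<^sup>2 * (\<Sum>n\<in>{0..<q}. (u0 n)\<^sup>2)"
  obtains E' u where "\<bar>E - E'\<bar> \<le> c" "periodic q u" "u \<noteq> (\<lambda>_. 0)"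
    "\<And>n. residual V E' u n = 0"
proof -
  define S where "S u = (\<Sum>n\<in>{0..<q}. (u n :: real)\<^sup>2)" for u
  define Q where "Q u = (\<Sum>n\<in>{0..<q}. (residual V E u n)\<^sup>2)" for u
  have S_zero: "u = (\<lambda>_. 0)" if "periodic q u" "S u = 0" for u
  proof
    fix n
    have "\<forall>n\<in>{0..<q}. (u n)\<^sup>2 = 0"
      using that(2) unfolding S_def by (subst (asm) sum_nonneg_eq_0_iff) auto
    then have "u (n mod q) = 0" using q by auto
    then show "u n = 0" using periodic_mod[OF that(1)] by simp
  qed
  have S_nonneg: "S u \<ge> 0" for u unfolding S_def by (rule sum_nonneg) auto
  have S_scale: "S (\<lambda>n. t * u n) = t\<^sup>2 * S u" for t u
    by (simp add: S_def power_mult_distrib sum_distrib_left)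
  have Q_scale: "Q (\<lambda>n. t * u n) = t\<^sup>2 * Q u" for t u
    by (simp add: Q_def residual_scale power_mult_distrib sum_distrib_left)
  \<comment> \<open>The unit sphere of periodic sequences in the product topology. The box is
    compact by Tychonoff, the other two conditions are closed, and unit vectors lie in the box
    anyway.\<close>
  define K where "K = PiE UNIV (\<lambda>_::int. {-1..1::real}) \<inter> {u. periodic q u} \<inter> {u. S u = 1}"
  have cc: "continuous_on UNIV (\<lambda>u. u i :: real)" for i :: int by simp
  have "compact (PiE UNIV (\<lambda>_::int. {-1..1::real}))"
    using compactin_PiE[of "\<lambda>_::int. euclidean :: real topology" UNIV "\<lambda>_. {-1..1}"]
    by (simp add: euclidean_product_topology)
  moreover have "closed {u :: int \<Rightarrow> real. periodic q u}"
    unfolding periodic_def by (intro closed_Collect_all closed_Collect_eq continuous_on_product_coordinates)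
  moreover have "closed {u. S u = 1}"
    unfolding S_def by (intro closed_Collect_eq continuous_intros continuous_on_product_coordinates)
  ultimately have "compact K" unfolding K_def by (intro compact_Int_closed)
  have K_I: "(\<lambda>n. u n / sqrt (S u)) \<in> K" if "periodic q u" "S u \<noteq> 0" for u
  proof -
    let ?v = "\<lambda>n. (1 / sqrt (S u)) * u n"
    have S1: "S ?v = 1" unfolding S_scale using S_nonneg[of u] that by (simp add: power_divide)
    have per: "periodic q ?v" using that by (simp add: periodic_def)
    have bd: "- 1 \<le> ?v n \<and> ?v n \<le> 1" for n
    proof -
      have "(?v (n mod q))\<^sup>2 \<le> S ?v"
        unfolding S_def by (rule member_le_sum) (use q in auto)
      then have "(?v (n mod q))\<^sup>2 \<le> 1" unfolding S1 .
      then have "- 1 \<le> ?v (n mod q) \<and> ?v (n mod q) \<le> 1"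
        unfolding abs_square_le_1 by linarith
      moreover have "?v n = ?v (n mod q)" using periodic_mod[OF per, of n] by (rule sym)
      ultimately show ?thesis by (simp only:)
    qed
    have "?v \<in> K" unfolding K_def
      by (intro IntI CollectI PiE_I S1 per) (use bd in \<open>simp_all only: atLeastAtMost_iff UNIV_I not_True_eq_False\<close>)
    then show ?thesis by simp
  qed
  have Su0: "S u0 \<noteq> 0" using S_zero[OF u0(1)] u0(2) by (metis)
  have "continuous_on K Q"
    unfolding Q_def residual_def
    by (intro continuous_intros continuous_on_subset[OF cc]) auto
  then obtain u where u: "u \<in> K" and min: "\<And>w. w \<in> K \<Longrightarrow> Q u \<le> Q w"
    using continuous_attains_inf[OF \<open>compact K\<close>, of Q] K_I[OF u0(1) Su0] by blast
  have per: "periodic q u" and Su: "S u = 1" using u by (auto simp: K_def)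
  have minw: "Q u * S w \<le> Q w" if "periodic q w" for w
  proof (cases "S w = 0")
    case True
    then show ?thesis by (simp add: Q_def sum_nonneg)
  next
    case False
    have "Q u \<le> Q (\<lambda>n. (1 / sqrt (S w)) * w n)" using min[OF K_I[OF that False]] by simp
    also have "\<dots> = Q w / S w" unfolding Q_scale using S_nonneg[of w] by (simp add: power_divide)
    finally show ?thesis using False S_nonneg[of w] by (simp add: field_simps)
  qed
  define l where "l = sqrt (Q u)"
  have "Q u \<ge> 0" by (simp add: Q_def sum_nonneg)
  then have l2: "l\<^sup>2 = Q u" and "l \<ge> 0" by (auto simp: l_def)
  have "Q u * S u0 \<le> c\<^sup>2 * S u0"
    using minw[OF u0(1)] le by (simp add: Q_def S_def)
  then have "l\<^sup>2 \<le> c\<^sup>2" using Su0 S_nonneg[of u0] l2 by simp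
  then have lc: "l \<le> c" using c by (rule power2_le_imp_le)
  have orth: "(\<Sum>n\<in>{0..<q}. residual V E u n * residual V E w n) = l\<^sup>2 * (\<Sum>n\<in>{0..<q}. u n * w n)"
    if w: "periodic q w" for w
  proof -
    have "(2 * (\<Sum>n\<in>{0..<q}. residual V E u n * residual V E w n)
         - 2 * l\<^sup>2 * (\<Sum>n\<in>{0..<q}. u n * w n)) = 0" (is "?b = 0")
    \<comment> \<open>Minimality says Q - \<open>l\<^sup>2\<close> S is nonnegative along u + t w;
      its terms of order zero cancel because S u = 1 and Q u = \<open>l\<^sup>2\<close>.\<close>
    proof (rule quadratic_nonneg_linear_coeff_zero)
      fix t
      have p: "periodic q (\<lambda>n. u n + t * w n)" using per w by (simp add: periodic_def)
      have "S (\<lambda>n. u n + t * w n) = S u + 2 * t * (\<Sum>n\<in>{0..<q}. u n * w n) + t\<^sup>2 * S w"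
        by (simp add: S_def power2_sum sum.distrib sum_distrib_left algebra_simps)
      moreover have "Q (\<lambda>n. u n + t * w n) = Q u
          + 2 * t * (\<Sum>n\<in>{0..<q}. residual V E u n * residual V E w n) + t\<^sup>2 * Q w"
        by (simp add: Q_def residual_lincomb power2_sum sum.distrib sum_distrib_left algebra_simps)
      ultimately show "0 \<le> t * ?b + t\<^sup>2 * (Q w - l\<^sup>2 * S w)"
        using minw[OF p] Su l2 by (simp add: algebra_simps)
    qed
    then show ?thesis by simp
  qed
  define z where "z n = residual V E (residual V E u) n - l\<^sup>2 * u n" for n
  have perD: "periodic q (residual V E u)" by (rule residual_periodic[OF V per])
  have perz: "periodic q z"
    using residual_periodic[OF V perD, of E] per by (simp add: periodic_def z_def)
  \<comment> \<open>\<open>z\<close> is used as its own test vector: symmetry and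
    \<open>orth\<close> make its squared norm vanish.\<close>
  have "S z = (\<Sum>n\<in>{0..<q}. residual V E (residual V E u) n * z n) - l\<^sup>2 * (\<Sum>n\<in>{0..<q}. u n * z n)"
    by (simp add: S_def z_def power2_eq_square left_diff_distrib sum_subtractf sum_distrib_left mult.assoc)
  also have "\<dots> = 0" using residual_symmetric[OF q V perD perz] orth[OF perz] by simp
  finally have z0: "z = (\<lambda>_. 0)" by (rule S_zero[OF perz])
  have fact2: "residual V E (residual V E u) n = l\<^sup>2 * u n" for n
    using fun_cong[OF z0, of n] by (simp add: z_def)
  have shiftE: "residual V (E + s) w n = residual V E w n - s * w n" for s w n
    by (simp add: residual_def algebra_simps)
  have un0: "u \<noteq> (\<lambda>_. 0)" using Su by (auto simp: S_def)
  \<comment> \<open>With (H - E - l)(H - E + l) u = 0, either the inner factor kills u, which gives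
    the eigenvalue E - l, or its image y is an eigenvector for E + l.\<close>
  show thesis
  proof (cases "\<forall>n. residual V E u n + l * u n = 0")
    case True
    have "residual V (E + - l) u n = 0" for n unfolding shiftE using True by simp
    then show thesis using that[of "E + - l" u] lc \<open>l \<ge> 0\<close> per un0 by simp
  next
    case False
    define y where "y n = residual V E u n + l * u n" for n
    have "residual V (E + l) y n = 0" for n
      unfolding shiftE y_def residual_lincomb fact2 by (simp add: algebra_simps power2_eq_square)
    moreover have "periodic q y" using perD per by (simp add: periodic_def y_def)
    moreover have "y \<noteq> (\<lambda>_. 0)" using False by (metis y_def)
    ultimately show thesis using that[of "E + l" y] lc \<open>l \<ge> 0\<close> by simp
  qed
qed

section \<open>Truncated plane waves\<close>

definition wave_packet :: "real \<Rightarrow> int \<Rightarrow> int \<Rightarrow> int \<Rightarrow> complex" where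
  "wave_packet \<theta> a l n = (if a \<le> n \<and> n < a + l then cis (\<theta> * of_int n) else 0)"

lemma cis_recurrence:
  "cis (\<theta> * of_int (n + 1)) + cis (\<theta> * of_int (n - 1)) = complex_of_real (2 * cos \<theta>) * cis (\<theta> * of_int n)"
  by (rule complex_eqI)
    (simp_all add: distrib_left right_diff_distrib cos_add cos_diff sin_add sin_diff)

text \<open>On the run the plane wave solves the equation exactly, so errors come only from the
  cutoff, at the two sites adjacent to each end. The bound 2 allows for a run of length 1, whose
  only site loses both neighbours.\<close>

lemma wave_packet_residual:
  assumes V: "\<And>n. a \<le> n \<Longrightarrow> n < a + l \<Longrightarrow> V n = c" and E: "E - c = 2 * cos \<theta>" and l: "l \<ge> 1"
  shows "cmod (schroedinger V (wave_packet \<theta> a l) n - complex_of_real E * wave_packet \<theta> a l n)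
    \<le> (if n \<in> {a - 1, a, a + l - 1, a + l} then 2 else 0)"
proof -
  let ?g = "wave_packet \<theta> a l"
  have nb: "cmod (?g m) \<le> 1" for m by (simp add: wave_packet_def)
  consider "n < a \<or> a + l \<le> n" | "a \<le> n" "n < a + l" by linarith
  then show ?thesis
  proof cases
    case 1
    then have 0: "?g n = 0" by (auto simp: wave_packet_def)
    show ?thesis
    proof (cases "n = a - 1 \<or> n = a + l")
      case True
      then show ?thesis using norm_triangle_ineq[of "?g (n + 1)" "?g (n - 1)"]
          nb[of "n + 1"] nb[of "n - 1"] by (auto simp: schroedinger_def 0)
    next
      case False
      then have "?g (n + 1) = 0" "?g (n - 1) = 0" using 1 by (auto simp: wave_packet_def)
      then show ?thesis by (auto simp: schroedinger_def 0)
    qed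
  next
    case 2
    let ?e = "\<lambda>m. cis (\<theta> * of_int m)"
    have "schroedinger V ?g n - complex_of_real E * ?g n
      = ?g (n + 1) + ?g (n - 1) - complex_of_real (E - c) * ?e n"
      using 2 V[of n] by (simp add: schroedinger_def wave_packet_def algebra_simps)
    also have "\<dots> = (?g (n + 1) - ?e (n + 1)) + (?g (n - 1) - ?e (n - 1))"
      unfolding E cis_recurrence[symmetric] by simp
    finally have eq: "schroedinger V ?g n - complex_of_real E * ?g n = \<dots>" .
    have d: "cmod (?g m - ?e m) \<le> (if a \<le> m \<and> m < a + l then 0 else 1)" for m
      by (simp add: wave_packet_def)
    have "cmod ((?g (n + 1) - ?e (n + 1)) + (?g (n - 1) - ?e (n - 1)))
      \<le> cmod (?g (n + 1) - ?e (n + 1)) + cmod (?g (n - 1) - ?e (n - 1))"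
      by (rule norm_triangle_ineq)
    also have "\<dots> \<le> (if n < a + l - 1 then 0 else 1) + (if a < n then 0 else 1)"
      using d[of "n + 1"] d[of "n - 1"] 2 by (intro add_mono) (simp_all split: if_splits)
    also have "\<dots> \<le> (if n \<in> {a - 1, a, a + l - 1, a + l} then 2 else 0)" using 2 by auto
    finally show ?thesis unfolding eq .
  qed
qed

text \<open>Four sites with squared error at most 4 each, whatever the length of the run. The packet
  itself has squared norm l, and the ratio 16 / l drives both uses of the packets.\<close>

lemma wave_packet_residual_sum:
  assumes V: "\<And>n. a \<le> n \<Longrightarrow> n < a + l \<Longrightarrow> V n = c" and E: "E - c = 2 * cos \<theta>" and l: "l \<ge> 1"
    and F: "finite F"
  shows "(\<Sum>n\<in>F. (cmod (schroedinger V (wave_packet \<theta> a l) n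
    - complex_of_real E * wave_packet \<theta> a l n))\<^sup>2) \<le> 16"
proof -
  let ?B = "{a - 1, a, a + l - 1, a + l}"
  have "(\<Sum>n\<in>F. (cmod (schroedinger V (wave_packet \<theta> a l) n
    - complex_of_real E * wave_packet \<theta> a l n))\<^sup>2) \<le> (\<Sum>n\<in>F. (if n \<in> ?B then 2 else 0)\<^sup>2)"
    by (intro sum_mono power_mono wave_packet_residual[OF V E l]) auto
  also have "\<dots> = (\<Sum>n\<in>F. if n \<in> ?B then 4 else 0)" by (intro sum.cong) auto
  also have "\<dots> = real (4 * card (F \<inter> ?B))"
    by (simp only: sum.inter_restrict[OF F, symmetric]) simp
  also have "card (F \<inter> ?B) \<le> card ?B" by (intro card_mono) auto
  also have "card ?B \<le> 4" by (simp add: card_insert_if)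
  finally show ?thesis by simp
qed

text \<open>The periodised packet has squared residual at most 16 against squared norm l, so
  minimisation finds an eigenvalue within the square root of 16 / l.\<close>

lemma periodic_eigenvalue_of_run:
  assumes V: "periodic q V" and run: "\<And>n. a \<le> n \<Longrightarrow> n < a + l \<Longrightarrow> V n = c"
    and l: "l \<ge> 1" "l + 2 \<le> q" and E: "\<bar>E - c\<bar> \<le> 2"
  obtains E' u where "\<bar>E - E'\<bar> \<le> 4 / sqrt (of_int l)" "periodic q u" "u \<noteq> (\<lambda>_. 0)"
    "\<And>n. residual V E' u n = 0"
proof -
  have q: "q > 0" using l by simp
  define \<theta> where "\<theta> = arccos ((E - c) / 2)"
  have \<theta>: "E - c = 2 * cos \<theta>" using E by (simp add: \<theta>_def cos_arccos abs_le_iff)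
  define g where "g = wave_packet \<theta> a l"
  define G where "G n = g (a + (n - a) mod q)" for n
  have perG: "periodic q G" by (simp add: periodic_def G_def algebra_simps flip: mod_add_left_eq) 
      (metis add_diff_eq mod_add_self1 add.commute)
  \<comment> \<open>The window starts at a - 2 because the residual at a - 1 reads that site; the
    periodised packet vanishes there since l + 2 \<le> q.\<close>
  have Gg: "G n = g n" if n: "a - 2 \<le> n" "n < a + q" for n
  proof (cases "n < a")
    case True
    have "(n - a) mod q = (n - a + q) mod q" by simp
    also have "\<dots> = n - a + q" using n True l by (intro mod_pos_pos_trivial) auto
    finally show ?thesis using True n l by (auto simp: G_def g_def wave_packet_def)
  qed (use n in \<open>simp add: G_def\<close>)
  let ?I = "{a - 1..<a - 1 + q}"
  have perRe: "periodic q (\<lambda>n. Re (G n))" and perIm: "periodic q (\<lambda>n. Im (G n))"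
    using perG by (simp_all add: periodic_def)
  have sumI: "(\<Sum>n\<in>{0..<q}. (w n)\<^sup>2) = (\<Sum>n\<in>?I. (w n)\<^sup>2)" if "periodic q w" for w :: "int \<Rightarrow> real"
    by (rule periodic_sum[symmetric]) (use that q in \<open>auto simp: periodic_def\<close>)
  have "(\<Sum>n\<in>{0..<q}. (residual V E (\<lambda>n. Re (G n)) n)\<^sup>2) + (\<Sum>n\<in>{0..<q}. (residual V E (\<lambda>n. Im (G n)) n)\<^sup>2)
     = (\<Sum>n\<in>?I. (residual V E (\<lambda>n. Re (G n)) n)\<^sup>2 + (residual V E (\<lambda>n. Im (G n)) n)\<^sup>2)"
    by (simp add: sumI[OF residual_periodic[OF V perRe]] sumI[OF residual_periodic[OF V perIm]] sum.distrib)
  also have "\<dots> = (\<Sum>n\<in>?I. (cmod (schroedinger V g n - complex_of_real E * g n))\<^sup>2)"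
  proof (rule sum.cong)
    fix n assume "n \<in> ?I"
    then have "G n = g n" "G (n + 1) = g (n + 1)" "G (n - 1) = g (n - 1)"
      by (auto intro!: Gg)
    then show "(residual V E (\<lambda>n. Re (G n)) n)\<^sup>2 + (residual V E (\<lambda>n. Im (G n)) n)\<^sup>2
      = (cmod (schroedinger V g n - complex_of_real E * g n))\<^sup>2"
      unfolding cmod_power2 by (simp add: residual_def schroedinger_def algebra_simps)
  qed simp
  also have "\<dots> \<le> 16" unfolding g_def by (rule wave_packet_residual_sum[OF run \<theta> l(1)]) auto
  finally have res: "(\<Sum>n\<in>{0..<q}. (residual V E (\<lambda>n. Re (G n)) n)\<^sup>2)
     + (\<Sum>n\<in>{0..<q}. (residual V E (\<lambda>n. Im (G n)) n)\<^sup>2) \<le> 16" .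
  have "(\<Sum>n\<in>{0..<q}. (Re (G n))\<^sup>2) + (\<Sum>n\<in>{0..<q}. (Im (G n))\<^sup>2) = (\<Sum>n\<in>?I. (cmod (G n))\<^sup>2)"
    by (simp add: sumI[OF perRe] sumI[OF perIm] sum.distrib cmod_power2)
  also have "\<dots> = (\<Sum>n\<in>?I. (cmod (g n))\<^sup>2)"
    by (intro sum.cong) (auto simp: Gg)
  also have "\<dots> = (\<Sum>n\<in>?I. if n \<in> {a..<a + l} then 1 else 0)"
    by (intro sum.cong) (auto simp: g_def wave_packet_def)
  also have "\<dots> = real (card (?I \<inter> {a..<a + l}))"
    by (subst sum.inter_restrict[symmetric]) simp_all
  also have "?I \<inter> {a..<a + l} = {a..<a + l}" using l by auto
  finally have mass: "(\<Sum>n\<in>{0..<q}. (Re (G n))\<^sup>2) + (\<Sum>n\<in>{0..<q}. (Im (G n))\<^sup>2) = of_int l"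
    using l by simp
  let ?c = "4 / sqrt (of_int l)"
  have c2: "?c\<^sup>2 = 16 / of_int l" using l by (simp add: power_divide)
  \<comment> \<open>Squared residuals and squared norms of the real and imaginary parts add up to
    those of the packet, so one of the two parts is nonzero and meets the ratio.\<close>
  have "\<exists>w m. periodic q w \<and> w m \<noteq> 0 \<and>
    (\<Sum>n\<in>{0..<q}. (residual V E w n)\<^sup>2) \<le> ?c\<^sup>2 * (\<Sum>n\<in>{0..<q}. (w n)\<^sup>2)"
  proof (rule ccontr)
    assume no: "\<not> ?thesis"
    have R: "?c\<^sup>2 * (\<Sum>n\<in>{0..<q}. (w n)\<^sup>2) \<le> (\<Sum>n\<in>{0..<q}. (residual V E w n)\<^sup>2) \<and>
       ((\<Sum>n\<in>{0..<q}. (w n)\<^sup>2) > 0 \<longrightarrow>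
       ?c\<^sup>2 * (\<Sum>n\<in>{0..<q}. (w n)\<^sup>2) < (\<Sum>n\<in>{0..<q}. (residual V E w n)\<^sup>2))"
      if "periodic q w" for w
    proof (cases "\<exists>m. w m \<noteq> 0")
      case True
      then show ?thesis using no that by (auto simp: not_le)
    qed (simp add: sum_nonneg)
    have "?c\<^sup>2 * of_int l < 16"
    proof (cases "(\<Sum>n\<in>{0..<q}. (Re (G n))\<^sup>2) > 0")
      case True
      then show ?thesis using R[OF perRe] R[OF perIm] res unfolding mass[symmetric] distrib_left
        by linarith
    next
      case False
      then have "(\<Sum>n\<in>{0..<q}. (Im (G n))\<^sup>2) > 0" using mass l by linarith
      then show ?thesis using R[OF perRe] R[OF perIm] res unfolding mass[symmetric] distrib_left
        by linarith
    qed
    then show False using l c2 by simp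
  qed
  then obtain w m where "periodic q w" "w m \<noteq> 0"
    "(\<Sum>n\<in>{0..<q}. (residual V E w n)\<^sup>2) \<le> ?c\<^sup>2 * (\<Sum>n\<in>{0..<q}. (w n)\<^sup>2)" by blast
  then show thesis using periodic_eigenvalue_near[OF q V, of w m ?c] that l by auto
qed

section \<open>Transfer matrices of periodic potentials\<close>

abbreviation op_norm :: "real^2^2 \<Rightarrow> real" where "op_norm A \<equiv> onorm ((*v) A)"

lemma op_norm_nonneg: "0 \<le> op_norm A"
  by (rule onorm_pos_le[OF matrix_vector_mul_bounded_linear])

lemma op_norm_mult: "op_norm (A ** B) \<le> op_norm A * op_norm B"
proof -
  have "(*v) (A ** B) = (*v) A \<circ> (*v) B" by (auto simp: matrix_vector_mul_assoc)
  then show ?thesis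
    using onorm_compose[OF matrix_vector_mul_bounded_linear[of A] matrix_vector_mul_bounded_linear[of B]]
    by simp
qed

lemma op_norm_add: "op_norm (A + B) \<le> op_norm A + op_norm B"
proof -
  have "(*v) (A + B) = (\<lambda>x. A *v x + B *v x)" by (auto simp: matrix_vector_mult_add_rdistrib)
  then show ?thesis
    using onorm_triangle[OF matrix_vector_mul_bounded_linear[of A] matrix_vector_mul_bounded_linear[of B]]
    by simp
qed

lemma op_norm_scaleR: "op_norm (c *\<^sub>R A) = \<bar>c\<bar> * op_norm A"
proof -
  have "(*v) (c *\<^sub>R A) = (\<lambda>x. c *\<^sub>R (A *v x))" by (auto simp: scaleR_matrix_vector_assoc)
  then show ?thesis
    using onorm_scaleR[OF matrix_vector_mul_bounded_linear[of A]] by simp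
qed

lemma op_norm_mat_1: "op_norm (mat 1) = 1"
proof -
  have "(*v) (mat 1 :: real^2^2) = (\<lambda>x. x)" by auto
  then show ?thesis by (simp add: onorm_id)
qed

lemma op_norm_le_norm: "op_norm A \<le> 4 * norm A"
proof -
  have "op_norm A \<le> real CARD(2) * real CARD(2) * norm A"
    by (rule onorm_le_matrix_component)
      (metis Finite_Cartesian_Product.norm_nth_le order_trans real_norm_def)
  then show ?thesis by simp
qed

lemma continuous_on_op_norm: "continuous_on UNIV op_norm"
proof -
  have le: "op_norm A - op_norm B \<le> 4 * norm (A - B)" for A B
    using op_norm_add[of "A - B" B] op_norm_le_norm[of "A - B"] by simp
  have "4-lipschitz_on UNIV op_norm"
  proof (rule lipschitz_onI)
    fix A B :: "real^2^2"
    show "dist (op_norm A) (op_norm B) \<le> 4 * dist A B"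
      using le[of A B] le[of B A] by (simp add: dist_norm norm_minus_commute abs_le_iff)
  qed simp
  then show ?thesis by (rule lipschitz_on_continuous_on)
qed

lemma continuous_on_op_norm_comp [continuous_intros]:
  "continuous_on S f \<Longrightarrow> continuous_on S (\<lambda>x. op_norm (f x))"
  by (rule continuous_on_compose2[OF continuous_on_op_norm]) auto

text \<open>Twice the determinant is at most the sum of the squared lengths of the columns, so both
  columns cannot be shorter than 1. This makes the logarithms nonnegative, which is the lower bound
  L \<ge> 0.\<close>

lemma op_norm_ge_1:
  assumes "det A = 1" shows "1 \<le> op_norm A"
proof -
  let ?M = "op_norm A"
  have b: "norm (A *v axis i 1) \<le> ?M" for i
    using onorm[OF matrix_vector_mul_bounded_linear[of A], of "axis i 1"] by simp
  have c: "A *v axis i 1 = (\<chi> k. A $ k $ i)" for i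
    by (simp add: matrix_vector_mult_basis column_def)
  have sq: "(A $ 1 $ i)\<^sup>2 + (A $ 2 $ i)\<^sup>2 \<le> ?M\<^sup>2" for i
  proof -
    have "(norm (A *v axis i 1))\<^sup>2 \<le> ?M\<^sup>2" using b by (intro power_mono) auto
    then show ?thesis by (simp add: c norm_vec_def L2_set_def sum_2)
  qed
  define a b c d where "a = A $ 1 $ 1" and "b = A $ 1 $ 2" and "c = A $ 2 $ 1" and "d = A $ 2 $ 2"
  have "a * d - b * c = 1" using assms by (simp add: det_2 a_def b_def c_def d_def)
  moreover have "a\<^sup>2 + c\<^sup>2 \<le> ?M\<^sup>2" "b\<^sup>2 + d\<^sup>2 \<le> ?M\<^sup>2"
    using sq by (simp_all add: a_def b_def c_def d_def)
  moreover have "2 * (a * d - b * c) \<le> (a\<^sup>2 + c\<^sup>2) + (b\<^sup>2 + d\<^sup>2)"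
    using sum_squares_ge_zero[of "a - d" "b + c"] by (simp add: algebra_simps power2_eq_square)
  ultimately have "1\<^sup>2 \<le> ?M\<^sup>2" unfolding one_power2 by argo
  then show ?thesis using op_norm_nonneg[of A] by (rule power2_le_imp_le)
qed

section \<open>Growth of transfer matrices\<close>

lemma det_transfer_matrix: "det (transfer_matrix E V N) = 1"
  by (induction N) (simp_all add: transfer_matrix_0 transfer_matrix_Suc det_mul, simp add: transfer_step_def det_2)

lemma op_norm_transfer_step: "op_norm (transfer_step E v) \<le> \<bar>E\<bar> + \<bar>v\<bar> + 2"
  using onorm_le_matrix_component_sum[of "transfer_step E v"]
  by (simp add: transfer_step_def sum_2)

lemma op_norm_transfer_matrix_le:
  assumes "\<And>n. \<bar>V n\<bar> \<le> 2" shows "op_norm (transfer_matrix E V N) \<le> (\<bar>E\<bar> + 4) ^ N"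
proof (induction N)
  case (Suc N)
  have "op_norm (transfer_step E (V (int N))) \<le> \<bar>E\<bar> + 4"
    using op_norm_transfer_step[of E "V (int N)"] assms[of "int N"] by simp
  then show ?case unfolding transfer_matrix_Suc power_Suc
    by (intro order_trans[OF op_norm_mult] mult_mono Suc op_norm_nonneg) auto
qed (simp add: transfer_matrix_0 onorm_id)

lemma transfer_matrix_add:
  "transfer_matrix E V (m + n) = transfer_matrix E (\<lambda>i. V (i + int m)) n ** transfer_matrix E V m"
  by (induction n) (simp_all add: transfer_matrix_0 transfer_matrix_Suc matrix_mul_assoc add.commute)

lemma transfer_matrix_cong:
  "(\<And>i. i < N \<Longrightarrow> V (int i) = W (int i)) \<Longrightarrow> transfer_matrix E V N = transfer_matrix E W N"
  by (induction N) (simp_all add: transfer_matrix_0 transfer_matrix_Suc)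

lemma continuous_on_transfer_matrix [continuous_intros]:
  "continuous_on S (\<lambda>E. transfer_matrix E V N)"
proof (induction N)
  case (Suc N)
  have "transfer_step E v = (\<chi> i j. if i = 1 then if j = 1 then E - v else - 1 else if j = 1 then 1 else 0)"
    for E v by (simp add: vec_eq_iff forall_2 transfer_step_def)
  moreover have "continuous_on S (\<lambda>E. if i = 1 then if j = 1 then E - v else - 1 else if j = 1 then 1 else 0)"
    for i j :: 2 and v :: real
    by (cases "i = 1"; cases "j = 1") (simp_all add: continuous_intros)
  ultimately have "continuous_on S (\<lambda>E. transfer_step E (V (int N)))"
    by (simp only:) (intro continuous_intros)
  then show ?case using Suc unfolding transfer_matrix_Suc matrix_matrix_mult_def
    by (intro continuous_intros)
qed (simp add: transfer_matrix_0)

lemma transfer_matrix_solution: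
  assumes "\<And>n. residual V E u n = 0"
  shows "transfer_matrix E V N *v vector [u 0, u (- 1)] = vector [u (int N), u (int N - 1)]"
proof (induction N)
  case (Suc N)
  have "u (int N + 1) = (E - V (int N)) * u (int N) - u (int N - 1)"
    using assms[of "int N"] by (simp add: residual_def algebra_simps)
  then show ?case
    by (simp add: transfer_matrix_Suc matrix_vector_mul_assoc[symmetric] Suc)
      (simp add: vec_eq_iff forall_2 transfer_step_def matrix_vector_mult_def sum_2 add.commute)
qed (simp add: transfer_matrix_0)

text \<open>One eigenvalue is 1 and their product is 1, so the trace is 2; Cayley-Hamilton then
  reads \<open>(P - 1)\<^sup>2 = 0\<close>.\<close>

lemma unipotent_square:
  fixes P :: "real^2^2"
  assumes det: "det P = 1" and w: "P *v w = w" "w \<noteq> 0"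
  shows "P ** P = 2 *\<^sub>R P - mat 1"
proof -
  define a b c d x y where "a = P $ 1 $ 1" and "b = P $ 1 $ 2" and "c = P $ 2 $ 1" and "d = P $ 2 $ 2"
    and "x = w $ 1" and "y = w $ 2"
  have D: "a * d - b * c = 1" using det by (simp add: det_2 a_def b_def c_def d_def)
  have e1: "(a - 1) * x + b * y = 0" and e2: "c * x + (d - 1) * y = 0"
    using w(1) by (simp_all add: vec_eq_iff forall_2 matrix_vector_mult_def sum_2
      a_def b_def c_def d_def x_def y_def algebra_simps)
  have xy: "x \<noteq> 0 \<or> y \<noteq> 0" using w(2) by (auto simp: vec_eq_iff forall_2 x_def y_def)
  have "((a - 1) * (d - 1) - b * c) * x = 0" "((a - 1) * (d - 1) - b * c) * y = 0"
    using e1 e2 by algebra+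
  then have "(a - 1) * (d - 1) - b * c = 0" using xy by auto
  then have tr: "a + d = 2" using D by (simp add: algebra_simps)
  have "a * a + b * c = 2 * a - 1" "a * b + b * d = 2 * b" "c * a + d * c = 2 * c" "c * b + d * d = 2 * d - 1"
    using D tr by algebra+
  then show ?thesis
    by (simp add: vec_eq_iff forall_2 matrix_matrix_mult_def sum_2 mat_def a_def b_def c_def d_def)
qed

text \<open>Over whole periods the products are powers of the monodromy matrix P; since P - 1
  squares to zero, the binomial expansion stops at first order.\<close>

lemma transfer_matrix_periodic_power:
  assumes V: "periodic (int q) V" and u: "periodic (int q) u" "u \<noteq> (\<lambda>_. 0)"
    and sol: "\<And>n. residual V E u n = 0"
  shows "transfer_matrix E V (m * q) = mat 1 + real m *\<^sub>R (transfer_matrix E V q - mat 1)"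
proof -
  define P where "P = transfer_matrix E V q"
  define w :: "real^2" where "w = vector [u 0, u (- 1)]"
  have "u (int q) = u 0" "u (int q - 1) = u (- 1)"
    using u(1)[unfolded periodic_def, rule_format, of 0] u(1)[unfolded periodic_def, rule_format, of "- 1"]
    by (simp_all add: add.commute)
  then have Pw: "P *v w = w" using transfer_matrix_solution[OF sol, of q] by (simp add: P_def w_def)
  \<comment> \<open>Two consecutive zeros of a solution propagate in both directions of the
    recurrence.\<close>
  have "w \<noteq> 0"
  proof
    assume "w = 0"
    then have "u 0 = 0" "u (- 1) = 0" by (simp_all add: w_def vec_eq_iff forall_2)
    then have "u n = 0 \<and> u (n - 1) = 0" for n
    proof (induction n rule: int_induct[where k = 0])
      case (step1 n)
      then show ?case using sol[of n] by (simp add: residual_def)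
    next
      case (step2 n)
      then show ?case using sol[of "n - 1"] by (simp add: residual_def)
    qed simp
    then show False using u(2) by auto
  qed
  then have PP: "P ** P = 2 *\<^sub>R P - mat 1"
    using unipotent_square[of P w] det_transfer_matrix Pw by (simp add: P_def)
  show ?thesis
  proof (induction m)
    case (Suc m)
    have "V (i + int (m * q)) = V i" for i
      using periodic_mult[OF V, of i "int m"] by (simp add: mult.commute)
    then have "transfer_matrix E V (Suc m * q) = P ** transfer_matrix E V (m * q)"
      using transfer_matrix_add[of E V "m * q" q] by (simp add: P_def add.commute)
    also have "\<dots> = P + real m *\<^sub>R (P ** P - P)"
      unfolding Suc P_def[symmetric]
      by (simp add: vec_eq_iff forall_2 matrix_matrix_mult_def sum_2 mat_def algebra_simps)
    also have "\<dots> = mat 1 + real (Suc m) *\<^sub>R (P - mat 1)"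
      unfolding PP by (simp add: vec_eq_iff mat_def algebra_simps)
    finally show ?case by (simp add: P_def)
  qed (simp add: transfer_matrix_0)
qed

text \<open>Whole periods grow linearly and the remainder, shorter than q, pays the trivial bound.
  The number of periods is crudely replaced by N.\<close>

lemma op_norm_transfer_matrix_linear_growth:
  assumes q: "q > 0" and V: "periodic (int q) V" "\<And>n. \<bar>V n\<bar> \<le> 2"
    and u: "periodic (int q) u" "u \<noteq> (\<lambda>_. 0)" and sol: "\<And>n. residual V E u n = 0"
  shows "op_norm (transfer_matrix E V N)
    \<le> (\<bar>E\<bar> + 4) ^ q * (1 + real N * ((\<bar>E\<bar> + 4) ^ q + 1))"
proof -
  define K where "K = (\<bar>E\<bar> + 4) ^ q"
  have K1: "K \<ge> 1" unfolding K_def by (rule one_le_power) simp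
  define m r where "m = N div q" and "r = N mod q"
  have N: "N = m * q + r" by (simp add: m_def r_def)
  have mN: "m \<le> N" by (simp add: m_def)
  have "op_norm (transfer_matrix E V (m * q))
     \<le> op_norm (mat 1) + real m * op_norm (transfer_matrix E V q - mat 1)"
    unfolding transfer_matrix_periodic_power[OF V(1) u sol]
    by (rule order_trans[OF op_norm_add]) (simp add: op_norm_scaleR)
  also have "op_norm (transfer_matrix E V q - mat 1) \<le> op_norm (transfer_matrix E V q) + op_norm (mat 1)"
    using op_norm_add[of "transfer_matrix E V q" "(- 1) *\<^sub>R mat 1"] unfolding op_norm_scaleR by simp
  also have "\<dots> \<le> K + 1"
    using op_norm_transfer_matrix_le[OF V(2), where E=E and N=q] by (simp add: op_norm_mat_1 K_def)
  also have "op_norm (mat 1) + real m * (K + 1) \<le> 1 + real N * (K + 1)"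
    using mN K1 by (simp add: op_norm_mat_1 mult_right_mono)
  finally have 1: "op_norm (transfer_matrix E V (m * q)) \<le> 1 + real N * (K + 1)"
    by (simp add: mult_left_mono)
  have "op_norm (transfer_matrix E (\<lambda>i. V (i + int (m * q))) r) \<le> (\<bar>E\<bar> + 4) ^ r"
    by (rule op_norm_transfer_matrix_le) (rule V)
  also have "\<dots> \<le> K" unfolding K_def
    by (rule power_increasing) (use q in \<open>auto simp: r_def less_imp_le\<close>)
  finally show ?thesis unfolding N transfer_matrix_add
    unfolding K_def[symmetric] N[symmetric] using 1 K1
    by (intro order_trans[OF op_norm_mult] mult_mono op_norm_nonneg) auto
qed

lemma linear_less_exp:
  fixes A B e :: real assumes "e > 0" "A \<ge> 0" "B \<ge> 0"
  shows "\<forall>\<^sub>F N in sequentially. A * (1 + real N * B) < exp (e * real N)"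
proof -
  \<comment> \<open>Beyond this threshold the quadratic Taylor term of the exponential alone exceeds
    the linear expression.\<close>
  obtain N0 where N0: "real N0 > 2 * (A + A * B) / e\<^sup>2" using reals_Archimedean2 by blast
  have "A * (1 + real N * B) < exp (e * real N)" if "N \<ge> max 1 N0" for N
  proof -
    have N: "real N \<ge> 1" "real N > 2 * (A + A * B) / e\<^sup>2" using that N0 by linarith+
    have "A * (1 + real N * B) \<le> real N * (A + A * B)"
      using mult_right_mono[OF N(1) assms(2)] by (simp add: algebra_simps)
    also have "\<dots> < real N * (real N * e\<^sup>2 / 2)"
      using N assms by (intro mult_strict_left_mono) (simp_all add: field_simps)
    also have "\<dots> = (e * real N)\<^sup>2 / 2" by (simp add: power2_eq_square)
    also have "\<dots> \<le> 1 + e * real N + (e * real N)\<^sup>2 / 2" using assms by simp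
    also have "\<dots> \<le> exp (e * real N)" using assms by (intro exp_lower_Taylor_quadratic) simp
    finally show ?thesis .
  qed
  then show ?thesis by (rule eventually_sequentiallyI)
qed

text \<open>The threshold at which the exponential wins depends on the energy; compactness leaves
  finitely many energies \<open>D\<close> and hence a common N. Uniformity in the phase holds
  because shifting potential and solution together does not change the constants of the growth
  bound.\<close>

lemma uniform_subexponential_energies:
  assumes q: "q > 0" and V: "periodic (int q) V" "\<And>n. \<bar>V n\<bar> \<le> 2" and e: "e > 0"
    and near: "\<And>E. E \<in> {-4..4} \<Longrightarrow> \<exists>E' u. \<bar>E - E'\<bar> < d \<and> periodic (int q) u \<and> u \<noteq> (\<lambda>_. 0)
      \<and> (\<forall>n. residual V E' u n = 0)"
  shows "\<exists>N\<ge>n0. \<forall>E\<in>{-4..4}. \<exists>E'. \<bar>E - E'\<bar> < d \<and>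
    (\<forall>j. op_norm (transfer_matrix E' (\<lambda>n. V (n + j)) N) < exp (e * real N))"
proof -
  define Z where "Z = {E'. \<exists>u. periodic (int q) u \<and> u \<noteq> (\<lambda>_. 0) \<and> (\<forall>n. residual V E' u n = 0)}"
  have "{-4..4} \<subseteq> (\<Union>E'\<in>Z. ball E' d)"
    using near by (fastforce simp: Z_def dist_real_def abs_minus_commute)
  then obtain D where D: "D \<subseteq> Z" "finite D" "{-4..4} \<subseteq> (\<Union>E'\<in>D. ball E' d)"
    using compactE_image[of "{-4..4::real}" Z "\<lambda>E'. ball E' d"] by auto
  have "\<forall>\<^sub>F N in sequentially. \<forall>j. op_norm (transfer_matrix E' (\<lambda>n. V (n + j)) N) < exp (e * real N)"
    if E': "E' \<in> D" for E'
  proof -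
    obtain u where u: "periodic (int q) u" "u \<noteq> (\<lambda>_. 0)" "\<And>n. residual V E' u n = 0"
      using D(1) E' unfolding Z_def by blast
    have bound: "op_norm (transfer_matrix E' (\<lambda>n. V (n + j)) N)
      \<le> (\<bar>E'\<bar> + 4) ^ q * (1 + real N * ((\<bar>E'\<bar> + 4) ^ q + 1))" for j N
    proof (rule op_norm_transfer_matrix_linear_growth[OF q periodic_shift[OF V(1)] _ periodic_shift[OF u(1)]])
      show "(\<lambda>n. u (n + j)) \<noteq> (\<lambda>_. 0)"
      proof
        assume "(\<lambda>n. u (n + j)) = (\<lambda>_. 0)"
        then have "u (n - j + j) = 0" for n by metis
        then show False using u(2) by auto
      qed
      show "residual (\<lambda>n. V (n + j)) E' (\<lambda>n. u (n + j)) n = 0" for n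
        using u(3)[of "n + j"] by (simp add: residual_def algebra_simps)
    qed (rule V)
    have "\<forall>\<^sub>F N in sequentially. (\<bar>E'\<bar> + 4) ^ q * (1 + real N * ((\<bar>E'\<bar> + 4) ^ q + 1)) < exp (e * real N)"
      by (rule linear_less_exp) (use e in auto)
    then show ?thesis
      by (rule eventually_mono) (blast intro: le_less_trans[OF bound])
  qed
  then have "\<forall>\<^sub>F N in sequentially. \<forall>E'\<in>D. \<forall>j.
      op_norm (transfer_matrix E' (\<lambda>n. V (n + j)) N) < exp (e * real N)"
    using D(2) by (intro eventually_ball_finite) auto
  then obtain N0 where N0: "\<And>N E' j. N \<ge> N0 \<Longrightarrow> E' \<in> D \<Longrightarrow>
      op_norm (transfer_matrix E' (\<lambda>n. V (n + j)) N) < exp (e * real N)"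
    unfolding eventually_sequentially by blast
  have near_D: "\<exists>E'\<in>D. \<bar>E - E'\<bar> < d" if "E \<in> {-4..4}" for E
    using D(3) that by (fastforce simp: dist_real_def abs_minus_commute)
  show ?thesis
  proof (rule exI[of _ "max n0 N0"], intro conjI ballI)
    show "max n0 N0 \<ge> n0" by simp
    fix E :: real assume "E \<in> {-4..4}"
    then obtain E' where "E' \<in> D" "\<bar>E - E'\<bar> < d" using near_D by blast
    then show "\<exists>E'. \<bar>E - E'\<bar> < d \<and>
        (\<forall>j. op_norm (transfer_matrix E' (\<lambda>n. V (n + j)) (max n0 N0)) < exp (e * real (max n0 N0)))"
      using N0[of "max n0 N0"] by (intro exI[of _ E']) simp
  qed
qed

section \<open>The dyadic odometer\<close>

text \<open>\<open>r k x\<close> is the residue of the 2-adic integer \<open>x\<close> modulo \<open>2 ^ k\<close>, and \<open>T\<close> adds one.\<close>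

locale dyadic_odometer = prob_space M for M :: "'a measure" +
  fixes T :: "'a \<Rightarrow> 'a" and r :: "nat \<Rightarrow> 'a \<Rightarrow> int"
  assumes T_bij: "bij_betw T (space M) (space M)"
    and r_T: "x \<in> space M \<Longrightarrow> r k (T x) = (r k x + 1) mod 2 ^ k"
    and r_Suc: "x \<in> space M \<Longrightarrow> r (Suc k) x mod 2 ^ k = r k x"
    and sets_eq: "sets M = sigma_sets (space M) (range (\<lambda>(k, a). {x \<in> space M. r k x = a}))"
    and prob_residue: "0 \<le> a \<Longrightarrow> a < 2 ^ k \<Longrightarrow> prob {x \<in> space M. r k x = a} = 1 / 2 ^ k"
begin

lemma residue_mod:
  assumes "j \<le> k" "x \<in> space M" shows "r k x mod 2 ^ j = r j x"
  using assms
proof (induction k rule: dec_induct)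
  case base
  show ?case using mod_mod_trivial[of "r (Suc j) x" "2 ^ j"] unfolding r_Suc[OF assms(2)] .
next
  case (step k)
  have "r (Suc k) x mod 2 ^ j = r (Suc k) x mod 2 ^ k mod 2 ^ j"
    using step by (simp add: mod_mod_cancel le_imp_power_dvd)
  then show ?case using step r_Suc by simp
qed

lemma residue_range: "x \<in> space M \<Longrightarrow> 0 \<le> r k x \<and> r k x < 2 ^ k"
  using residue_mod[of k k x] pos_mod_sign[of "2 ^ k" "r k x"] pos_mod_bound[of "2 ^ k" "r k x"] by simp

definition cylinder :: "nat \<Rightarrow> int \<Rightarrow> 'a set" where "cylinder k a = {x \<in> space M. r k x = a}"

lemma cylinder_sets: "cylinder k a \<in> sets M"
  unfolding sets_eq cylinder_def by (rule sigma_sets.Basic) auto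

lemma residue_measurable [measurable]: "r k \<in> measurable M (count_space UNIV)"
proof -
  have "r k -` {a} \<inter> space M = cylinder k a" for a by (auto simp: cylinder_def)
  then show ?thesis by (simp add: measurable_count_space_eq2_countable cylinder_sets)
qed

lemma sets_eq_cylinder: "sets M = sigma_sets (space M) (range (case_prod cylinder))"
  unfolding sets_eq cylinder_def by simp

lemma prob_cylinder: "prob (cylinder k a) = (if 0 \<le> a \<and> a < 2 ^ k then 1 / 2 ^ k else 0)"
proof (cases "0 \<le> a \<and> a < 2 ^ k")
  case False
  then have "cylinder k a = {}" using residue_range by (fastforce simp: cylinder_def)
  then show ?thesis using False by auto
qed (auto simp: cylinder_def prob_residue)

text \<open>Cylinders are nested or disjoint, because a residue determines all residues of lower
  level.\<close>

lemma Int_stable_cylinder: "Int_stable (range (case_prod cylinder))"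
proof (rule Int_stableI)
  have 1: "cylinder j a \<inter> cylinder k b \<in> range (case_prod cylinder)" if "j \<le> k" for j k a b
  proof (cases "b mod 2 ^ j = a")
    case True
    then have "cylinder j a \<inter> cylinder k b = cylinder k b"
      using residue_mod[OF that] by (auto simp: cylinder_def)
    then show ?thesis by auto
  next
    case False
    \<comment> \<open>The only residue modulo 1 is 0, so \<open>cylinder 0 1\<close> represents the
      empty set within the generator.\<close>
    then have "cylinder j a \<inter> cylinder k b = cylinder 0 1"
      using residue_mod[OF that] residue_range[of _ 0] by (force simp: cylinder_def)
    then show ?thesis by auto
  qed
  fix A B assume "A \<in> range (case_prod cylinder)" "B \<in> range (case_prod cylinder)"
  then obtain j a k b where "A = cylinder j a" "B = cylinder k b" by auto
  then show "A \<inter> B \<in> range (case_prod cylinder)"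
    using 1[of j k a b] 1[of k j b a] by (cases "j \<le> k") (simp_all add: Int_commute)
qed

lemma measure_eqI_cylinder:
  assumes "sets N = sets M" "sets N' = sets M" "emeasure N (space M) \<noteq> \<infinity>"
    and "\<And>k a. emeasure N (cylinder k a) = emeasure N' (cylinder k a)"
  shows "N = N'"
proof (rule measure_eqI_generator_eq[OF Int_stable_cylinder])
  have "cylinder 0 0 = space M" using residue_range[of _ 0] by (force simp: cylinder_def)
  then show "(\<Union>i::nat. cylinder 0 0) = space M" "emeasure N (cylinder 0 0) \<noteq> \<infinity>" for i
    using assms(3) by auto
qed (use assms in \<open>auto simp: sets_eq_cylinder[symmetric]\<close>, auto simp: cylinder_def)

lemma measurable_endo:
  assumes g: "\<And>x. x \<in> space M \<Longrightarrow> g x \<in> space M"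
    and rg: "\<And>x k. x \<in> space M \<Longrightarrow> r k (g x) = h k (r k x)"
  shows "g \<in> measurable M M"
proof (rule measurable_sigma_sets[OF sets_eq_cylinder])
  fix A assume "A \<in> range (case_prod cylinder)"
  then obtain k a where "A = cylinder k a" by auto
  then have "g -` A \<inter> space M = {x \<in> space M. h k (r k x) = a}"
    using g rg by (auto simp: cylinder_def)
  then show "g -` A \<inter> space M \<in> sets M" by simp
qed (use g in \<open>auto simp: cylinder_def\<close>)

lemma T_space: "x \<in> space M \<Longrightarrow> T x \<in> space M"
  using T_bij by (auto simp: bij_betw_def)

lemma T_measurable [measurable]: "T \<in> measurable M M"
  using T_space r_T by (rule measurable_endo)

lemma T_inv:
  assumes "x \<in> space M"
  shows "the_inv_into (space M) T x \<in> space M" "T (the_inv_into (space M) T x) = x"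
  using bij_betwE[OF bij_betw_the_inv_into[OF T_bij]] f_the_inv_into_f_bij_betw[OF T_bij] assms by auto

lemma r_T_inv:
  assumes "x \<in> space M" shows "r k (the_inv_into (space M) T x) = (r k x - 1) mod 2 ^ k"
proof -
  let ?y = "the_inv_into (space M) T x"
  have "(r k x - 1) mod 2 ^ k = (r k (T ?y) - 1) mod 2 ^ k" using T_inv assms by simp
  also have "\<dots> = r k ?y mod 2 ^ k" using r_T[of ?y k] T_inv[OF assms] by (simp add: mod_diff_left_eq)
  finally show ?thesis using residue_mod[of k k] T_inv[OF assms] by simp
qed

lemma T_inv_measurable: "the_inv_into (space M) T \<in> measurable M M"
  using T_inv(1) r_T_inv by (rule measurable_endo)

lemma T_vimage_cylinder:
  assumes "0 \<le> a" "a < 2 ^ k"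
  shows "T -` cylinder k a \<inter> space M = cylinder k ((a - 1) mod 2 ^ k)"
proof -
  have "(b + 1) mod 2 ^ k = a \<longleftrightarrow> b = (a - 1) mod 2 ^ k" if "0 \<le> b" "b < 2 ^ k" for b
  proof
    assume "(b + 1) mod 2 ^ k = a"
    then have "(a - 1) mod 2 ^ k = b mod 2 ^ k" by (auto simp: mod_diff_left_eq)
    then show "b = (a - 1) mod 2 ^ k" using that by simp
  qed (use assms in \<open>simp add: mod_add_left_eq\<close>)
  then have "r k (T x) = a \<longleftrightarrow> r k x = (a - 1) mod 2 ^ k" if "x \<in> space M" for x
    using that residue_range r_T by simp
  then show ?thesis using T_space by (auto simp: cylinder_def)
qed

text \<open>\<open>T\<close> permutes the residue classes of each level, which all have the same
  mass, and cylinders determine the measure.\<close>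

lemma distr_T: "distr M M T = M"
proof (rule measure_eqI_cylinder)
  interpret D: prob_space "distr M M T" by (rule prob_space_distr) simp
  show "emeasure (distr M M T) (space M) \<noteq> \<infinity>" using D.emeasure_space_1 by simp
  fix k a
  have "prob (T -` cylinder k a \<inter> space M) = prob (cylinder k a)"
  proof (cases "0 \<le> a \<and> a < 2 ^ k")
    case True
    then show ?thesis by (simp add: T_vimage_cylinder prob_cylinder)
  next
    case False
    then have "cylinder k a = {}" using residue_range by (fastforce simp: cylinder_def)
    then show ?thesis by simp
  qed
  then show "emeasure (distr M M T) (cylinder k a) = emeasure M (cylinder k a)"
    by (simp add: emeasure_distr cylinder_sets emeasure_eq_measure)
qed simp_all

lemma invertible_mpt: "invertible_mpt M T"
  unfolding invertible_mpt_def using T_bij T_measurable T_inv_measurable distr_T by blast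

lemma prob_T_vimage: "A \<in> events \<Longrightarrow> prob (T -` A \<inter> space M) = prob A"
  using measure_distr[of T M M A] distr_T by simp

text \<open>An invariant set meets all residue classes modulo \<open>2 ^ k\<close> equally, so it is independent of itself.\<close>

lemma ergodic: "ergodic M T"
  unfolding ergodic_def
proof (intro ballI impI)
  fix A assume A [measurable]: "A \<in> sets M" and inv: "T -` A \<inter> space M = A"
  have step: "prob (A \<inter> cylinder k a) = prob (A \<inter> cylinder k ((a - 1) mod 2 ^ k))"
    if "0 \<le> a" "a < 2 ^ k" for k a
  proof -
    have "T -` (A \<inter> cylinder k a) \<inter> space M = A \<inter> cylinder k ((a - 1) mod 2 ^ k)"
      using inv T_vimage_cylinder[OF that] by blast
    then show ?thesis using prob_T_vimage[of "A \<inter> cylinder k a"] cylinder_sets by simp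
  qed
  \<comment> \<open>By \<open>step\<close> the piece of A in a class has the mass of the piece in
    the preceding class; induction compares every class with class 0.\<close>
  have eq0: "prob (A \<inter> cylinder k (int a)) = prob (A \<inter> cylinder k 0)" if "int a < 2 ^ k" for k a
    using that
  proof (induction a)
    case (Suc a)
    have a: "int a < 2 ^ k" using Suc.prems by linarith
    then have "(int (Suc a) - 1) mod 2 ^ k = int a"
      using mod_pos_pos_trivial[of "int a" "2 ^ k"] by simp
    then show ?case using Suc.IH[OF a] Suc.prems step[of "int (Suc a)" k] by simp
  qed simp
  have eq: "prob (A \<inter> cylinder k a) = prob (A \<inter> cylinder k 0)" if "0 \<le> a" "a < 2 ^ k" for k a
    using eq0[of "nat a" k, unfolded nat_0_le[OF that(1)]] that(2) .
  have indep: "prob (A \<inter> cylinder k a) = prob A / 2 ^ k" if "0 \<le> a" "a < 2 ^ k" for k a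
  proof -
    have "A = (\<Union>b\<in>{0..<2 ^ k}. A \<inter> cylinder k b)"
      using sets.sets_into_space[OF A] residue_range by (fastforce simp: cylinder_def)
    then have "prob A = prob (\<Union>b\<in>{0..<2 ^ k}. A \<inter> cylinder k b)" by simp
    also have "\<dots> = (\<Sum>b\<in>{0..<2 ^ k}. prob (A \<inter> cylinder k b))"
    proof (rule finite_measure_finite_Union)
      show "(\<lambda>b. A \<inter> cylinder k b) ` {0..<2 ^ k} \<subseteq> events"
        using A cylinder_sets by blast
      show "disjoint_family_on (\<lambda>b. A \<inter> cylinder k b) {0..<2 ^ k}"
        by (auto simp: disjoint_family_on_def cylinder_def)
    qed simp
    also have "\<dots> = (\<Sum>b\<in>{0..<2 ^ k :: int}. prob (A \<inter> cylinder k 0))"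
      by (intro sum.cong refl eq) auto
    finally have "prob A = 2 ^ k * prob (A \<inter> cylinder k 0)" by (simp add: nat_power_eq)
    then show ?thesis using eq[OF that] by simp
  qed
  \<comment> \<open>Independence of A from cylinders extends to all events by uniqueness of
    measures; tested on A itself it gives p = \<open>p\<^sup>2\<close>.\<close>
  have "density M (indicator A) = scale_measure (ennreal (prob A)) M"
  proof (rule measure_eqI_cylinder)
    show "emeasure (density M (indicator A)) (space M) \<noteq> \<infinity>"
      by (simp add: emeasure_restricted)
    fix k a
    have "prob (A \<inter> cylinder k a) = prob A * prob (cylinder k a)"
    proof (cases "0 \<le> a \<and> a < 2 ^ k")
      case True
      then show ?thesis by (simp add: indep prob_cylinder)
    next
      case False
      then have "cylinder k a = {}" using residue_range by (fastforce simp: cylinder_def)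
      then show ?thesis by simp
    qed
    then show "emeasure (density M (indicator A)) (cylinder k a)
      = emeasure (scale_measure (ennreal (prob A)) M) (cylinder k a)"
      by (simp add: emeasure_restricted cylinder_sets emeasure_eq_measure ennreal_mult')
  qed simp_all
  then have "emeasure (density M (indicator A)) A = emeasure (scale_measure (ennreal (prob A)) M) A"
    by simp
  then have "prob A = prob A * prob A"
    by (simp add: emeasure_restricted emeasure_eq_measure ennreal_mult'[symmetric])
  then show "prob A = 0 \<or> prob A = 1" by simp
qed

lemma int_iterate_space:
  assumes "x \<in> space M" shows "int_iterate M T n x \<in> space M"
proof -
  have "(T ^^ i) x \<in> space M" for i by (induction i) (use assms T_space in auto)
  moreover have "(the_inv_into (space M) T ^^ i) x \<in> space M" for i
    by (induction i) (use assms T_inv in auto)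
  ultimately show ?thesis by (simp add: int_iterate_def)
qed

lemma residue_int_iterate:
  assumes x: "x \<in> space M" shows "r k (int_iterate M T n x) = (r k x + n) mod 2 ^ k"
proof (induction n rule: int_induct[where k = 0])
  case base
  then show ?case using residue_mod[of k k] x by (simp add: int_iterate_def)
next
  case (step1 n)
  then show ?case using int_iterate_add_one[OF T_bij x, of n] r_T[OF int_iterate_space[OF x]]
    by (simp add: mod_add_left_eq add.assoc)
next
  case (step2 n)
  let ?y = "int_iterate M T (n - 1) x"
  have "r k ?y = (r k ?y + 1 - 1) mod 2 ^ k" using residue_mod[of k k] int_iterate_space[OF x] by simp
  also have "\<dots> = ((r k ?y + 1) mod 2 ^ k - 1) mod 2 ^ k" by (simp add: mod_diff_left_eq)
  also have "(r k ?y + 1) mod 2 ^ k = (r k x + n) mod 2 ^ k"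
    using step2 int_iterate_add_one[OF T_bij x, of "n - 1"] r_T[OF int_iterate_space[OF x], of k "n - 1"]
    by simp
  finally show ?case by (simp add: mod_diff_left_eq algebra_simps)
qed

lemma prob_residue_less:
  "prob {x \<in> space M. (r k x + n) mod 2 ^ k < int c} \<le> real c / 2 ^ k"
proof -
  have "{x \<in> space M. (r k x + n) mod 2 ^ k < int c} \<subseteq> (\<Union>b<c. cylinder k ((int b - n) mod 2 ^ k))"
  proof
    fix x assume x: "x \<in> {x \<in> space M. (r k x + n) mod 2 ^ k < int c}"
    define b where "b = nat ((r k x + n) mod 2 ^ k)"
    have "int b = (r k x + n) mod 2 ^ k" by (simp add: b_def)
    then have "(int b - n) mod 2 ^ k = r k x" "b < c"
      using x residue_mod[of k k x] by (auto simp: mod_diff_left_eq)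
    then show "x \<in> (\<Union>b<c. cylinder k ((int b - n) mod 2 ^ k))"
      using x by (intro UN_I[of b]) (auto simp: cylinder_def)
  qed
  then have "prob {x \<in> space M. (r k x + n) mod 2 ^ k < int c}
    \<le> prob (\<Union>b<c. cylinder k ((int b - n) mod 2 ^ k))"
    by (rule finite_measure_mono) (auto intro!: sets.finite_UN cylinder_sets)
  also have "\<dots> \<le> (\<Sum>b<c. prob (cylinder k ((int b - n) mod 2 ^ k)))"
    by (rule finite_measure_subadditive_finite) (auto intro!: cylinder_sets)
  also have "\<dots> = real c / 2 ^ k" by (simp add: prob_cylinder)
  finally show ?thesis .
qed

text \<open>This allows the exceptional orbits to be deleted, so that a property holding almost
  surely becomes one holding at every point. Residue classes keep their mass because only a null set
  is removed.\<close>

lemma restrict: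
  assumes A: "A \<in> events" "prob A = 1" and bij: "bij_betw T A A"
  shows "dyadic_odometer (restrict_space M A) T r"
proof -
  have sp: "space (restrict_space M A) = A"
    using sets.sets_into_space[OF A(1)] by (auto simp: space_restrict_space)
  have AM: "A \<subseteq> space M" by (rule sets.sets_into_space[OF A(1)])
  show ?thesis
  proof (rule dyadic_odometer.intro)
    show "prob_space (restrict_space M A)"
      by (rule prob_spaceI) (use A in \<open>simp add: sp emeasure_restrict_space emeasure_eq_measure\<close>)
    show "dyadic_odometer_axioms (restrict_space M A) T r"
    proof
      show "sets (restrict_space M A) = sigma_sets (space (restrict_space M A))
        (range (\<lambda>(k, a). {x \<in> space (restrict_space M A). r k x = a}))"
      proof -
        have "(\<inter>) A ` range (case_prod cylinder) = range (\<lambda>(k, a). {x \<in> A. r k x = a})"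
          using AM by (auto simp: cylinder_def image_image intro!: image_eqI)
        then show ?thesis
          unfolding sets_restrict_space sp sets_eq_cylinder
          using sigma_sets_Int[of A "space M" "range (case_prod cylinder)"] A(1) AM
          by (simp add: sets_eq_cylinder[symmetric])
      qed
      fix a :: int and k :: nat assume a: "0 \<le> a" "a < 2 ^ k"
      have "prob (A \<inter> cylinder k a) = prob (cylinder k a)"
        using A cylinder_sets
        by (intro measure_eq_AE) (auto simp: AE_in_set_eq_1[OF A(1), symmetric] elim: eventually_mono)
      moreover have "A \<inter> cylinder k a = {x \<in> A. r k x = a}" using AM by (auto simp: cylinder_def)
      ultimately show "measure (restrict_space M A) {x \<in> space (restrict_space M A). r k x = a} = 1 / 2 ^ k"
        using a A(1) AM by (simp add: sp measure_restrict_space prob_cylinder)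
    qed (use AM bij r_T r_Suc in \<open>auto simp: sp\<close>)
  qed
qed

end

section \<open>The potential along the odometer\<close>

lemma infsum_finite_support:
  fixes g :: "int \<Rightarrow> real"
  assumes "finite F" "\<And>n. n \<notin> F \<Longrightarrow> g n = 0"
  shows "g summable_on UNIV" "infsum g UNIV = sum g F"
proof -
  have "(g has_sum sum g F) F" using assms(1) by (rule has_sum_finite)
  then have "(g has_sum sum g F) UNIV" using assms(2)
    by (subst has_sum_cong_neutral[where T = F and g = g]) auto
  then show "g summable_on UNIV" "infsum g UNIV = sum g F"
    by (auto simp: has_sum_imp_summable infsumI)
qed

text \<open>Weyl's criterion: a resolvent bounded by C would send the residual of a packet, of norm
  at most 4, back to the packet, of norm sqrt l; this fails once l exceeds the square of 4
  \<bar>C\<bar>.\<close>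

lemma real_interval_subset_spectrum_of_runs:
  assumes runs: "\<And>l c. c \<in> {2, - 2} \<Longrightarrow> \<exists>a. \<forall>n. a \<le> n \<longrightarrow> n < a + int l \<longrightarrow> V n = c"
  shows "complex_of_real ` {-4..4} \<subseteq> ell2_spectrum (schroedinger V)"
proof
  fix z assume "z \<in> complex_of_real ` {-4..4}"
  then obtain E where E: "E \<in> {-4..4}" "z = complex_of_real E" by auto
  \<comment> \<open>The sign of E selects the run value at distance at most 2, so that E - c is of
    the form 2 cos \<theta>.\<close>
  define c :: real where "c = (if E \<ge> 0 then 2 else - 2)"
  have c: "c \<in> {2, - 2}" "\<bar>E - c\<bar> \<le> 2" using E by (auto simp: c_def)
  define \<theta> where "\<theta> = arccos ((E - c) / 2)"
  have \<theta>: "E - c = 2 * cos \<theta>"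
    using c(2) cos_arccos[of "(E - c) / 2"] by (simp add: \<theta>_def abs_le_iff)
  show "z \<in> ell2_spectrum (schroedinger V)"
    unfolding ell2_spectrum_def
  proof (rule CollectI, rule notI)
    assume "\<exists>R. ell2_bounded_linear R \<and> (\<forall>u\<in>ell2. R (\<lambda>n. schroedinger V u n - z * u n) = u) \<and>
      (\<forall>u\<in>ell2. (\<lambda>n. schroedinger V (R u) n - z * R u n) = u)"
    then obtain R C where R: "\<And>u. u \<in> ell2 \<Longrightarrow> R (\<lambda>n. schroedinger V u n - z * u n) = u"
      and C: "\<And>u. u \<in> ell2 \<Longrightarrow> ell2_norm (R u) \<le> C * ell2_norm u"
      unfolding ell2_bounded_linear_def by blast
    obtain l :: nat where l: "real l > (4 * \<bar>C\<bar>)\<^sup>2" using reals_Archimedean2 by blast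
    have l1: "int l \<ge> 1" using l zero_le_power2[of "4 * \<bar>C\<bar>"] by linarith
    obtain a where a: "\<And>n. a \<le> n \<Longrightarrow> n < a + int l \<Longrightarrow> V n = c" using runs[OF c(1)] by blast
    define g where "g = wave_packet \<theta> a (int l)"
    define h where "h n = schroedinger V g n - z * g n" for n
    have g0: "(cmod (g n))\<^sup>2 = 0" if "n \<notin> {a..<a + int l}" for n
      using that by (auto simp: g_def wave_packet_def)
    have h0: "(cmod (h n))\<^sup>2 = 0" if "n \<notin> {a - 1, a, a + int l - 1, a + int l}" for n
      using wave_packet_residual[where V = V and a = a and c = c, OF a \<theta> l1, of n] that by (simp add: h_def g_def E)
    note gs = infsum_finite_support[where F = "{a..<a + int l}" and g = "\<lambda>n. (cmod (g n))\<^sup>2", OF _ g0]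
      and hs = infsum_finite_support[where F = "{a - 1, a, a + int l - 1, a + int l}"
        and g = "\<lambda>n. (cmod (h n))\<^sup>2", OF _ h0]
    have "g \<in> ell2" "h \<in> ell2" using gs(1) hs(1) by (auto simp: ell2_def)
    have "ell2_norm h = sqrt (\<Sum>n\<in>{a - 1, a, a + int l - 1, a + int l}. (cmod (h n))\<^sup>2)"
      unfolding ell2_norm_def by (subst hs(2)) simp_all
    also have "\<dots> \<le> sqrt 16"
      unfolding h_def g_def E by (intro real_sqrt_le_mono wave_packet_residual_sum[where V = V and a = a and c = c, OF a \<theta> l1]) auto
    finally have nh: "ell2_norm h \<le> 4" by simp
    have "(\<Sum>n\<in>{a..<a + int l}. (cmod (g n))\<^sup>2) = (\<Sum>n\<in>{a..<a + int l}. 1)"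
      by (intro sum.cong) (auto simp: g_def wave_packet_def)
    then have "ell2_norm g = sqrt l" unfolding ell2_norm_def by (subst gs(2)) simp_all
    moreover have "R h = g" using R[OF \<open>g \<in> ell2\<close>] by (simp add: h_def[abs_def])
    ultimately have "sqrt l \<le> C * ell2_norm h" using C[OF \<open>h \<in> ell2\<close>] by simp
    also have "\<dots> \<le> \<bar>C\<bar> * 4"
      using nh by (intro mult_mono) (auto simp: ell2_norm_def infsum_nonneg)
    finally have "real l \<le> (4 * \<bar>C\<bar>)\<^sup>2"
      by (metis abs_ge_zero mult.commute mult_nonneg_nonneg real_le_lsqrt sqrt_le_D zero_le_numeral)
    then show False using l by simp
  qed
qed

text \<open>Here \<open>\<rho> k\<close> is the residue of a point modulo the period of
  \<open>v k\<close>. The default -2 also covers points where the stage values do not settle, so the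
  limit is defined, two-valued and measurable everywhere.\<close>

definition limit_potential :: "(nat \<Rightarrow> int) \<Rightarrow> (nat \<Rightarrow> int \<Rightarrow> real) \<Rightarrow> int \<Rightarrow> real" where
  "limit_potential \<rho> v n = (if \<exists>K. \<forall>k\<ge>K. v k (\<rho> k + n) = 2 then 2 else - 2)"

lemma limit_potential_values: "limit_potential \<rho> v n \<in> {- 2, 2}"
  by (simp add: limit_potential_def)

lemma abs_limit_potential: "\<bar>limit_potential \<rho> v n\<bar> \<le> 2"
  by (simp add: limit_potential_def)

text \<open>All phases \<open>j\<close> are included because a point of the odometer sees the stage
  potential at an arbitrary phase. The strict inequality makes the condition open in
  \<open>E\<close> for periodic \<open>V\<close>.\<close>

definition subexponential_energy :: "(int \<Rightarrow> real) \<Rightarrow> nat \<Rightarrow> real \<Rightarrow> real \<Rightarrow> bool" where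
  "subexponential_energy V N e E \<longleftrightarrow>
     (\<forall>j. op_norm (transfer_matrix E (\<lambda>n. V (n + j)) N) < exp (e * real N))"

text \<open>
  Stage \<open>k + 1\<close> overwrites, once per period \<open>2 ^ s (k + 1)\<close>, a block of stage \<open>k\<close> by \<open>k + 1\<close>
  twos followed by \<open>k + 1\<close> minus twos; by \<open>overwrite_rare\<close> this is rare on the scale \<open>N j\<close> of
  every earlier stage.
\<close>

locale run_construction =
  fixes s :: "nat \<Rightarrow> nat" and v :: "nat \<Rightarrow> int \<Rightarrow> real" and N :: "nat \<Rightarrow> nat"
  assumes v_periodic: "periodic (2 ^ s k) (v k)"
    and v_values: "v k n \<in> {- 2, 2}"
    and v_Suc: "v (Suc k) n = (if n mod 2 ^ s (Suc k) < int (Suc k) then 2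
      else if n mod 2 ^ s (Suc k) < int (2 * Suc k) then - 2 else v k n)"
    and s_mono: "s k \<le> s (Suc k)"
    and N_large: "2 * 2 ^ s k \<le> N k"
    and overwrite_rare: "j \<le> m \<Longrightarrow>
      real (2 * Suc m) / 2 ^ s (Suc m) \<le> (1 / 2) ^ Suc m / (real (N j) * real (Suc j))"
    and good_energy: "k > 0 \<Longrightarrow> E \<in> {-4..4} \<Longrightarrow>
      \<exists>E'. \<bar>E - E'\<bar> < 5 / sqrt k \<and> subexponential_energy (v k) (N k) (1 / Suc k) E'"
begin

lemma N_pos: "N k > 0"
  using N_large[of k] by (metis gr0I le_zero_eq mult_is_0 power_not_zero zero_neq_numeral)

text \<open>Rarity with \<open>j = m\<close> bounds the proportion of overwritten sites by 1, so
  both runs fit into one period.\<close>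

lemma run_length_le: "int (2 * Suc m) \<le> 2 ^ s (Suc m)"
proof -
  have "real (2 * Suc m) / 2 ^ s (Suc m) \<le> (1 / 2) ^ Suc m / (real (N m) * real (Suc m))"
    by (rule overwrite_rare) simp
  also have "\<dots> \<le> 1 / 1"
  proof (rule frac_le)
    have "1 * 1 \<le> real (N m) * real (Suc m)" using N_pos[of m] by (intro mult_mono) auto
    then show "1 \<le> real (N m) * real (Suc m)" by simp
    show "(1 / 2) ^ Suc m \<le> (1::real)" by (rule power_le_one) auto
  qed simp_all
  finally have "real (2 * Suc m) \<le> 2 ^ s (Suc m)" by simp
  then have "real (2 * Suc m) \<le> real (2 ^ s (Suc m))" by simp
  then have "2 * Suc m \<le> 2 ^ s (Suc m)" by (simp only: of_nat_le_iff)
  then have "int (2 * Suc m) \<le> int (2 ^ s (Suc m))" by (simp only: of_nat_le_iff)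
  then show ?thesis by simp
qed

lemma v_run:
  assumes "i < 2 * Suc k" shows "v (Suc k) (int i) = (if i < Suc k then 2 else - 2)"
proof -
  have "int i < int (2 * Suc k)" using assms by (simp only: of_nat_less_iff)
  then have "int i < 2 ^ s (Suc k)" using run_length_le[of k] by (rule less_le_trans)
  then have "int i mod 2 ^ s (Suc k) = int i" by (rule mod_pos_pos_trivial[rotated]) simp
  then show ?thesis using assms by (simp add: v_Suc)
qed

end

locale run_odometer = dyadic_odometer M T r + run_construction s v N
  for M :: "'a measure" and T r s v N
begin

abbreviation W :: "'a \<Rightarrow> int \<Rightarrow> real" where "W x \<equiv> limit_potential (\<lambda>k. r (s k) x) v"

text \<open>The stage values are constant from \<open>k\<close> on: each stage copies the previous
  one off its overwritten sites, and by periodicity \<open>v m\<close> agrees at the residues of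
  levels \<open>s m\<close> and \<open>s (Suc m)\<close>.\<close>

lemma W_eq_stage:
  assumes x: "x \<in> space M"
    and no: "\<And>m. k \<le> m \<Longrightarrow> \<not> (r (s (Suc m)) x + n) mod 2 ^ s (Suc m) < int (2 * Suc m)"
  shows "W x n = v k (r (s k) x + n)"
proof -
  have const: "v m (r (s m) x + n) = v k (r (s k) x + n)" if "k \<le> m" for m
    using that
  proof (induction m rule: dec_induct)
    case (step m)
    let ?R = "r (s (Suc m)) x + n"
    have "?R mod 2 ^ s m = (r (s (Suc m)) x mod 2 ^ s m + n) mod 2 ^ s m" by (simp add: mod_add_left_eq)
    also have "\<dots> = (r (s m) x + n) mod 2 ^ s m" using residue_mod[OF s_mono x] by simp
    finally have R: "v m ?R = v m (r (s m) x + n)"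
      using periodic_mod[OF v_periodic[of m]] by metis
    have "v (Suc m) ?R = v m ?R" using no[of m] step by (simp add: v_Suc)
    then show ?case using step R by simp
  qed simp
  show ?thesis
  proof (cases "v k (r (s k) x + n) = 2")
    case True
    have "v m (r (s m) x + n) = 2" if "k \<le> m" for m using const[OF that] True by (rule trans)
    then show ?thesis using True by (auto simp: limit_potential_def)
  next
    case False
    have "\<not> (\<exists>K. \<forall>m\<ge>K. v m (r (s m) x + n) = 2)"
    proof (rule notI, elim exE)
      fix K assume "\<forall>m\<ge>K. v m (r (s m) x + n) = 2"
      then have "v (max K k) (r (s (max K k)) x + n) = 2" by simp
      then show False using False const[of "max K k"] by simp
    qed
    then show ?thesis using False v_values[of k] by (auto simp: limit_potential_def)
  qed
qed

lemma W_int_iterate: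
  assumes "x \<in> space M" shows "W (int_iterate M T n x) m = W x (n + m)"
proof -
  have "v k (r (s k) (int_iterate M T n x) + m) = v k (r (s k) x + (n + m))" for k
  proof -
    have "((r (s k) x + n) mod 2 ^ s k + m) mod 2 ^ s k = (r (s k) x + (n + m)) mod 2 ^ s k"
      by (simp add: mod_add_left_eq add.assoc)
    then show ?thesis
      unfolding residue_int_iterate[OF assms] using periodic_mod[OF v_periodic[of k]] by metis
  qed
  then show ?thesis by (simp add: limit_potential_def)
qed

lemma potential_eq_W: "x \<in> space M \<Longrightarrow> potential M T (\<lambda>x. W x 0) x = W x"
  by (rule ext) (simp add: potential_def W_int_iterate)

lemma W_measurable [measurable]: "(\<lambda>x. W x n) \<in> borel_measurable M"
  unfolding limit_potential_def by measurable

lemma residue_Collect_sets: "{x \<in> space M. P (r k x)} \<in> sets M"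
  by measurable

lemma mismatch_measurable [measurable]:
  "{x \<in> space M. \<exists>i<L. W x (j + int i) \<noteq> v k (r (s k) x + (j + int i))} \<in> sets M"
proof -
  have "(\<lambda>x. v k (r (s k) x + m)) \<in> borel_measurable M" for m by measurable
  then show ?thesis by measurable
qed

text \<open>A mismatch needs a later stage that overwrites one of the L sites. The union bound over
  sites and stages converges because the costs of the stages are dominated by a geometric series
  with sum 1.\<close>

lemma mismatch_prob:
  "prob {x \<in> space M. \<exists>i<L. W x (j + int i) \<noteq> v k (r (s k) x + (j + int i))}
    \<le> real L / (real (N k) * real (Suc k))" (is "prob ?B \<le> _")
proof -
  define D where "D m n = {x \<in> space M. (r (s (Suc m)) x + n) mod 2 ^ s (Suc m) < int (2 * Suc m)}" for m n
  have D[measurable]: "D m n \<in> sets M" for m n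
    unfolding D_def by (rule residue_Collect_sets)
  define c where "c = 1 / (real (N k) * real (Suc k))"
  have "c \<ge> 0" by (simp add: c_def)
  have pD: "prob (\<Union>i<L. D (k + m) (j + int i)) \<le> real L * c * (1 / 2) ^ Suc m" for m
  proof -
    have "prob (\<Union>i<L. D (k + m) (j + int i)) \<le> (\<Sum>i<L. prob (D (k + m) (j + int i)))"
      by (rule finite_measure_subadditive_finite) auto
    also have "\<dots> \<le> (\<Sum>i<L. c * (1 / 2) ^ Suc m)"
    proof (rule sum_mono)
      fix i
      have "prob (D (k + m) (j + int i)) \<le> real (2 * Suc (k + m)) / 2 ^ s (Suc (k + m))"
        unfolding D_def by (rule prob_residue_less)
      also have "\<dots> \<le> (1 / 2) ^ Suc (k + m) / (real (N k) * real (Suc k))"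
        \<comment> \<open>Applied with \<open>j\<close> equal to \<open>k\<close>, so that every
          later stage is measured against the fixed scale \<open>N k\<close>.\<close>
        by (rule overwrite_rare) simp
      also have "\<dots> = c * (1 / 2) ^ Suc (k + m)" by (simp add: c_def)
      also have "\<dots> \<le> c * (1 / 2) ^ Suc m"
        using \<open>c \<ge> 0\<close> by (intro mult_left_mono power_decreasing) auto
      finally show "prob (D (k + m) (j + int i)) \<le> c * (1 / 2) ^ Suc m" .
    qed
    finally show ?thesis by simp
  qed
  have sums: "(\<lambda>m. real L * c * (1 / 2) ^ Suc m) sums (real L * c)"
    using sums_mult[OF power_half_series, of "real L * c"] by simp
  have summ: "summable (\<lambda>m. prob (\<Union>i<L. D (k + m) (j + int i)))"
    by (rule summable_comparison_test'[OF sums_summable[OF sums], of 0]) (use pD in auto)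
  have "?B \<subseteq> (\<Union>m. \<Union>i<L. D (k + m) (j + int i))"
  proof
    fix x assume x: "x \<in> ?B"
    then obtain i where i: "i < L" "W x (j + int i) \<noteq> v k (r (s k) x + (j + int i))" by blast
    then obtain m where "k \<le> m" "(r (s (Suc m)) x + (j + int i)) mod 2 ^ s (Suc m) < int (2 * Suc m)"
      using W_eq_stage[of x k "j + int i"] x by blast
    then have "x \<in> D (k + (m - k)) (j + int i)" using x by (simp add: D_def)
    then show "x \<in> (\<Union>m. \<Union>i<L. D (k + m) (j + int i))" using i(1) by blast
  qed
  then have "prob ?B \<le> prob (\<Union>m. \<Union>i<L. D (k + m) (j + int i))"
    by (rule finite_measure_mono) measurable
  also have "\<dots> \<le> (\<Sum>m. prob (\<Union>i<L. D (k + m) (j + int i)))"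
    by (rule finite_measure_subadditive_countably) (use summ in auto)
  also have "\<dots> \<le> real L * c"
    using suminf_le[OF pD summ sums_summable[OF sums]] sums_unique[OF sums] by simp
  finally show ?thesis by (simp add: c_def)
qed

section \<open>The Lyapunov exponent along good scales\<close>

lemma log_transfer_measurable [measurable]:
  "(\<lambda>x. ln (op_norm (transfer_matrix E (\<lambda>i. W x (i + j)) n))) \<in> borel_measurable M"
proof -
  have "(\<lambda>x. transfer_matrix E (\<lambda>i. W x (i + j)) n) \<in> borel_measurable M"
  proof (induction n)
    case (Suc n)
    have "(\<lambda>x. A ** transfer_matrix E (\<lambda>i. W x (i + j)) n) \<in> borel_measurable M" for A :: "real^2^2"
      by (rule borel_measurable_continuous_on[OF _ Suc])
        (simp add: matrix_matrix_mult_def continuous_intros)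
    \<comment> \<open>As the potential is two-valued, the new factor is a choice between two
      constant matrices, and each product is a continuous image of the previous one.\<close>
    then have "(\<lambda>x. if W x (int n + j) = 2 then transfer_step E 2 ** transfer_matrix E (\<lambda>i. W x (i + j)) n
      else transfer_step E (- 2) ** transfer_matrix E (\<lambda>i. W x (i + j)) n) \<in> borel_measurable M"
      by measurable
    also have "(\<lambda>x. if W x (int n + j) = 2 then transfer_step E 2 ** transfer_matrix E (\<lambda>i. W x (i + j)) n
      else transfer_step E (- 2) ** transfer_matrix E (\<lambda>i. W x (i + j)) n)
      = (\<lambda>x. transfer_matrix E (\<lambda>i. W x (i + j)) (Suc n))"
    proof
      fix x
      have "W x (int n + j) = 2 \<or> W x (int n + j) = - 2"
        using limit_potential_values[of "\<lambda>k. r (s k) x" v "int n + j"] by auto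
      then show "(if W x (int n + j) = 2 then transfer_step E 2 ** transfer_matrix E (\<lambda>i. W x (i + j)) n
        else transfer_step E (- 2) ** transfer_matrix E (\<lambda>i. W x (i + j)) n)
        = transfer_matrix E (\<lambda>i. W x (i + j)) (Suc n)"
        by (auto simp: transfer_matrix_Suc)
    qed
    finally show ?case .
  qed (simp add: transfer_matrix_0)
  then have "(\<lambda>x. op_norm (transfer_matrix E (\<lambda>i. W x (i + j)) n)) \<in> borel_measurable M"
    by (rule borel_measurable_continuous_on[OF continuous_on_op_norm])
  then show ?thesis by measurable
qed

lemma log_transfer_bounds:
  assumes "E \<in> {-4..4}"
  shows "0 \<le> ln (op_norm (transfer_matrix E (\<lambda>i. W x (i + j)) n))"
    and "ln (op_norm (transfer_matrix E (\<lambda>i. W x (i + j)) n)) \<le> real n * ln 8"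
proof -
  let ?c = "op_norm (transfer_matrix E (\<lambda>i. W x (i + j)) n)"
  have 1: "1 \<le> ?c" by (rule op_norm_ge_1[OF det_transfer_matrix])
  then show "0 \<le> ln ?c" by simp
  have "?c \<le> (\<bar>E\<bar> + 4) ^ n" by (rule op_norm_transfer_matrix_le[OF abs_limit_potential])
  also have "\<dots> \<le> 8 ^ n" using assms by (intro power_mono) auto
  finally have "ln ?c \<le> ln (8 ^ n)" using 1 by (intro ln_mono) auto
  then show "ln ?c \<le> real n * ln 8" by (simp add: ln_realpow)
qed

text \<open>The offset \<open>j\<close> is kept because splitting a product leaves one factor on a
  shifted window; the bounds below are uniform in it.\<close>

definition mean_log_norm :: "real \<Rightarrow> int \<Rightarrow> nat \<Rightarrow> real" where
  "mean_log_norm E j n = (\<integral>x. ln (op_norm (transfer_matrix E (\<lambda>i. W x (i + j)) n)) \<partial>M)"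

lemma log_transfer_integrable:
  assumes "E \<in> {-4..4}"
  shows "integrable M (\<lambda>x. ln (op_norm (transfer_matrix E (\<lambda>i. W x (i + j)) n)))"
  by (rule integrable_const_bound[of _ "real n * ln 8"]) (use log_transfer_bounds[OF assms] in auto)

lemma mean_log_norm_bounds:
  assumes "E \<in> {-4..4}"
  shows "0 \<le> mean_log_norm E j n" "mean_log_norm E j n \<le> real n * ln 8"
proof -
  show "0 \<le> mean_log_norm E j n"
    unfolding mean_log_norm_def by (rule Bochner_Integration.integral_nonneg) (use log_transfer_bounds[OF assms] in auto)
  have "mean_log_norm E j n \<le> (\<integral>x. real n * ln 8 \<partial>M)"
    unfolding mean_log_norm_def
    by (rule integral_mono[OF log_transfer_integrable[OF assms]]) (use log_transfer_bounds[OF assms] in auto)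
  then show "mean_log_norm E j n \<le> real n * ln 8" by (simp add: prob_space)
qed

lemma mean_log_norm_add:
  assumes E: "E \<in> {-4..4}"
  shows "mean_log_norm E j (m + n) \<le> mean_log_norm E j m + mean_log_norm E (j + int m) n"
proof -
  let ?g = "\<lambda>j n x. op_norm (transfer_matrix E (\<lambda>i. W x (i + j)) n)"
  have "ln (?g j (m + n) x) \<le> ln (?g j m x) + ln (?g (j + int m) n x)" for x
  proof -
    have eq: "(\<lambda>i. W x (i + int m + j)) = (\<lambda>i. W x (i + (j + int m)))" by (simp add: algebra_simps)
    have "?g j (m + n) x \<le> ?g (j + int m) n x * ?g j m x"
      using op_norm_mult[of "transfer_matrix E (\<lambda>i. W x (i + (j + int m))) n" "transfer_matrix E (\<lambda>i. W x (i + j)) m"]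
      unfolding transfer_matrix_add eq .
    moreover have "1 \<le> ?g j n x" for j n by (rule op_norm_ge_1[OF det_transfer_matrix])
    note this[of j "m + n"] this[of j m] this[of "j + int m" n]
    ultimately have "ln (?g j (m + n) x) \<le> ln (?g (j + int m) n x * ?g j m x)"
      "?g (j + int m) n x > 0" "?g j m x > 0" by (auto intro!: ln_mono)
    then show ?thesis by (simp add: ln_mult)
  qed
  then have "mean_log_norm E j (m + n) \<le> (\<integral>x. ln (?g j m x) + ln (?g (j + int m) n x) \<partial>M)"
    unfolding mean_log_norm_def using log_transfer_integrable[OF E] by (intro integral_mono) auto
  then show ?thesis
    unfolding mean_log_norm_def using log_transfer_integrable[OF E] by simp
qed

text \<open>Off the mismatch set the window is one of \<open>v k\<close>, whose growth rate is below
  1 / Suc k. On that set, of probability at most 1 / Suc k, each step costs at most ln 8.\<close>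

lemma mean_log_norm_good:
  assumes E: "E \<in> {-4..4}" and good: "subexponential_energy (v k) (N k) (1 / Suc k) E"
  shows "mean_log_norm E j (N k) \<le> real (N k) * ((1 + ln 8) / Suc k)"
proof -
  define B where "B = {x \<in> space M. \<exists>i<N k. W x (j + int i) \<noteq> v k (r (s k) x + (j + int i))}"
  have B[measurable]: "B \<in> sets M" unfolding B_def by measurable
  have iB: "integrable M (indicat_real B)"
    by (rule integrable_real_indicator[OF B]) (simp add: emeasure_eq_measure)
  have pB: "prob B \<le> 1 / Suc k" using mismatch_prob[of "N k" j k] N_pos[of k] by (simp add: B_def)
  have "ln (op_norm (transfer_matrix E (\<lambda>i. W x (i + j)) (N k)))
    \<le> real (N k) / Suc k + real (N k) * ln 8 * indicator B x" if x: "x \<in> space M" for x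
  proof (cases "x \<in> B")
    case True
    then show ?thesis using log_transfer_bounds(2)[OF E, of x j "N k"] by (simp add: add_increasing)
  next
    case False
    have "transfer_matrix E (\<lambda>i. W x (i + j)) (N k) = transfer_matrix E (\<lambda>n. v k (n + (r (s k) x + j))) (N k)"
      using False x by (intro transfer_matrix_cong) (auto simp: B_def algebra_simps)
    then have le: "op_norm (transfer_matrix E (\<lambda>i. W x (i + j)) (N k)) < exp (1 / Suc k * real (N k))"
      using good by (simp add: subexponential_energy_def)
    have "ln (op_norm (transfer_matrix E (\<lambda>i. W x (i + j)) (N k))) \<le> ln (exp (1 / Suc k * real (N k)))"
      using le op_norm_ge_1[OF det_transfer_matrix] by (intro ln_mono) (auto intro: less_le_trans[of 0 1])
    then show ?thesis using False by simp
  qed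
  then have "mean_log_norm E j (N k) \<le> (\<integral>x. real (N k) / Suc k + real (N k) * ln 8 * indicator B x \<partial>M)"
    unfolding mean_log_norm_def using log_transfer_integrable[OF E] iB
    by (intro integral_mono Bochner_Integration.integrable_add integrable_mult_right) auto
  also have "\<dots> = real (N k) / Suc k + real (N k) * ln 8 * prob B"
    using iB by (subst Bochner_Integration.integral_add) (auto simp: prob_space)
  also have "\<dots> \<le> real (N k) / Suc k + real (N k) * ln 8 * (1 / Suc k)"
    using pB by (intro add_left_mono mult_left_mono) auto
  also have "\<dots> = real (N k) * ((1 + ln 8) / Suc k)"
    by (simp add: add_divide_distrib distrib_left)
  finally show ?thesis .
qed

lemma mean_log_norm_multiple:
  assumes E: "E \<in> {-4..4}" and b: "\<And>j. mean_log_norm E j p \<le> b"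
  shows "mean_log_norm E j (m * p + t) \<le> real m * b + real t * ln 8"
proof (induction m arbitrary: j)
  case 0
  then show ?case using mean_log_norm_bounds(2)[OF E] by simp
next
  case (Suc m)
  have "mean_log_norm E j (p + (m * p + t)) \<le> b + (real m * b + real t * ln 8)"
    by (rule order_trans[OF mean_log_norm_add[OF E]]) (intro add_mono b Suc)
  then show ?case by (simp add: algebra_simps)
qed

text \<open>A single good scale bounds the growth rate at all large lengths, by cutting them into
  blocks of length \<open>N k\<close>. Good scales with arbitrarily large \<open>k\<close> push this
  bound to 0.\<close>

lemma lyapunov_zero:
  assumes E: "E \<in> {-4..4}" and good: "\<And>K. \<exists>k\<ge>K. subexponential_energy (v k) (N k) (1 / Suc k) E"
  shows "lyapunov M T (\<lambda>x. W x 0) E = 0"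
proof -
  have "(\<lambda>n. mean_log_norm E 0 n / real n) \<longlonglongrightarrow> 0"
  proof (rule LIMSEQ_I)
    fix e :: real assume e: "e > 0"
    have ln8: "ln 8 > (0::real)" by simp
    obtain K :: nat where K: "real K > 2 * (1 + ln 8) / e" using reals_Archimedean2 by blast
    obtain k where k: "k \<ge> K" "subexponential_energy (v k) (N k) (1 / Suc k) E" using good by blast
    define \<beta> where "\<beta> = (1 + ln 8) / Suc k"
    have \<beta>: "\<beta> < e / 2" "\<beta> \<ge> 0"
    proof -
      have "2 * (1 + ln 8) / e < real (Suc k)" using K k(1) by simp
      then show "\<beta> < e / 2" using e by (simp add: \<beta>_def field_simps)
      show "\<beta> \<ge> 0" using ln8 by (simp add: \<beta>_def)
    qed
    \<comment> \<open>From here on the incomplete block, costing at most \<open>N k\<close> times ln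
      8, is below n e / 2.\<close>
    obtain n0 :: nat where n0: "real n0 > 2 * (real (N k) * ln 8) / e" using reals_Archimedean2 by blast
    show "\<exists>n0. \<forall>n\<ge>n0. norm (mean_log_norm E 0 n / real n - 0) < e"
    proof (intro exI allI impI)
      fix n assume n: "n \<ge> max 1 n0"
      define m t where "m = n div N k" and "t = n mod N k"
      have eq: "n = m * N k + t" by (simp add: m_def t_def)
      have "mean_log_norm E 0 n \<le> real m * (real (N k) * \<beta>) + real t * ln 8"
        unfolding eq by (rule mean_log_norm_multiple[OF E]) (use mean_log_norm_good[OF E k(2)] in \<open>simp add: \<beta>_def\<close>)
      also have "\<dots> \<le> real n * \<beta> + real (N k) * ln 8"
      proof (rule add_mono)
        have "real m * real (N k) \<le> real n" using eq by (metis le_add1 of_nat_le_iff of_nat_mult)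
        then show "real m * (real (N k) * \<beta>) \<le> real n * \<beta>" using \<beta>(2) mult_right_mono
          by (fastforce simp: mult.assoc[symmetric])
        show "real t * ln 8 \<le> real (N k) * ln 8"
          using N_pos[of k] by (intro mult_right_mono) (auto simp: t_def less_imp_le)
      qed
      also have "\<dots> < real n * (e / 2) + real n * (e / 2)"
      proof (rule add_strict_mono)
        show "real n * \<beta> < real n * (e / 2)" using n \<beta>(1) by simp
        have "2 * (real (N k) * ln 8) / e < real n" using n n0 by linarith
        then show "real (N k) * ln 8 < real n * (e / 2)" using e by (simp add: field_simps)
      qed
      also have "\<dots> = e * real n" by simp
      finally have "mean_log_norm E 0 n / real n < e" using n by (subst pos_divide_less_eq) auto
      then show "norm (mean_log_norm E 0 n / real n - 0) < e"
        using mean_log_norm_bounds(1)[OF E, of 0 n] by simp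
    qed
  qed
  moreover have "(\<integral>x. ln (op_norm (transfer_matrix E (potential M T (\<lambda>x. W x 0) x) n)) \<partial>M) = mean_log_norm E 0 n" for n
    unfolding mean_log_norm_def by (rule Bochner_Integration.integral_cong) (simp_all add: potential_eq_W)
  ultimately show ?thesis unfolding lyapunov_def by (simp add: limI)
qed

section \<open>Almost sure presence of the runs\<close>

definition contains_runs :: "nat \<Rightarrow> 'a set" where
  "contains_runs k = {x \<in> space M. \<exists>n. \<forall>i<2 * Suc k. W x (n + int i) = v (Suc k) (int i)}"

lemma contains_runs_sets [measurable]: "contains_runs k \<in> sets M"
  unfolding contains_runs_def by measurable

lemma W_T: "x \<in> space M \<Longrightarrow> W (T x) n = W x (1 + n)"
  using W_int_iterate[of x 1 n] by (simp add: int_iterate_def)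

text \<open>The position of the block is existentially quantified, so a shift only renames it;
  ergodicity thus turns positive probability into probability one.\<close>

lemma contains_runs_invariant: "T -` contains_runs k \<inter> space M = contains_runs k"
proof -
  have "(\<exists>n. \<forall>i<2 * Suc k. W x (1 + (n + int i)) = v (Suc k) (int i)) \<longleftrightarrow>
      (\<exists>n. \<forall>i<2 * Suc k. W x (n + int i) = v (Suc k) (int i))" (is "?L \<longleftrightarrow> ?R") for x
  proof
    assume ?L
    then obtain n where "\<forall>i<2 * Suc k. W x ((1 + n) + int i) = v (Suc k) (int i)"
      by (auto simp: add.assoc)
    then show ?R by blast
  next
    assume ?R
    then obtain n where "\<forall>i<2 * Suc k. W x (1 + ((n - 1) + int i)) = v (Suc k) (int i)"
      by (auto simp: algebra_simps)
    then show ?L by blast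
  qed
  note shift = this
  have "T x \<in> contains_runs k \<longleftrightarrow> x \<in> contains_runs k" if "x \<in> space M" for x
    by (simp only: contains_runs_def mem_Collect_eq W_T[OF that] T_space[OF that] shift that)
  then show ?thesis by (auto simp: contains_runs_def)
qed

text \<open>It suffices to exclude probability 0. Points with residue 0 at level
  \<open>s (Suc k)\<close> start with the block unless a later stage disturbs it, and
  \<open>N_large\<close> makes that disturbance strictly less likely than the residue class.\<close>

lemma prob_contains_runs: "prob (contains_runs k) = 1"
proof (rule ccontr)
  assume "prob (contains_runs k) \<noteq> 1"
  then have 0: "prob (contains_runs k) = 0"
    using ergodic[unfolded ergodic_def, rule_format, OF contains_runs_sets contains_runs_invariant, of k] by simp
  let ?k = "Suc k"
  define B where "B = {x \<in> space M. \<exists>i<2 * ?k. W x (0 + int i) \<noteq> v ?k (r (s ?k) x + (0 + int i))}"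
  have B[measurable]: "B \<in> sets M" unfolding B_def by measurable
  have "cylinder (s ?k) 0 \<subseteq> contains_runs k \<union> B"
  proof
    fix x assume x: "x \<in> cylinder (s ?k) 0"
    show "x \<in> contains_runs k \<union> B"
    proof (cases "x \<in> B")
      case False
      then have "\<forall>i<2 * ?k. W x (0 + int i) = v ?k (int i)" using x by (auto simp: B_def cylinder_def)
      then have "\<exists>n. \<forall>i<2 * ?k. W x (n + int i) = v ?k (int i)" by (rule exI)
      then show ?thesis using x unfolding contains_runs_def cylinder_def by blast
    qed simp
  qed
  then have "prob (cylinder (s ?k) 0) \<le> prob (contains_runs k \<union> B)"
    by (rule finite_measure_mono) measurable
  also have "\<dots> \<le> prob (contains_runs k) + prob B" by (rule measure_Un_le) measurable
  also have "\<dots> \<le> real (2 * ?k) / (real (N ?k) * real (Suc ?k))"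
    using mismatch_prob[of "2 * ?k" 0 ?k] 0 by (simp only: B_def)
  also have "\<dots> \<le> real (2 * ?k) / ((2 * 2 ^ s ?k) * real (Suc ?k))"
  proof (intro divide_left_mono mult_right_mono mult_pos_pos)
    have "real (2 * 2 ^ s ?k) \<le> real (N ?k)" using N_large[of ?k] by (simp only: of_nat_le_iff)
    then show "2 * 2 ^ s ?k \<le> real (N ?k)" by simp
  qed (use N_pos[of ?k] in auto)
  also have "\<dots> = real ?k / real (Suc ?k) * (1 / 2 ^ s ?k)"
    unfolding of_nat_mult of_nat_numeral mult.assoc mult_divide_mult_cancel_left_if by (simp add: mult.commute)
  also have "\<dots> < 1 * (1 / 2 ^ s ?k)" by (intro mult_strict_right_mono) auto
  finally show False by (simp add: prob_cylinder)
qed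

lemma spectrum:
  assumes "x \<in> (\<Inter>k. contains_runs k)"
  shows "complex_of_real ` {-4..4} \<subseteq> ell2_spectrum (schroedinger (W x))"
proof (rule real_interval_subset_spectrum_of_runs)
  fix l :: nat and c :: real assume c: "c \<in> {2, - 2}"
  obtain n where n: "\<And>i. i < 2 * Suc l \<Longrightarrow> W x (n + int i) = v (Suc l) (int i)"
    using assms by (auto simp: contains_runs_def)
  \<comment> \<open>The block of stage \<open>Suc l\<close> consists of a run of 2 and then a run of
    -2, each of length \<open>Suc l\<close>; \<open>b\<close> is the start of the run with value
    \<open>c\<close>.\<close>
  define b where "b = (if c = 2 then 0 else Suc l)"
  show "\<exists>a. \<forall>m. a \<le> m \<longrightarrow> m < a + int l \<longrightarrow> W x m = c"
  proof (intro exI allI impI)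
    fix m assume m: "n + int b \<le> m" "m < n + int b + int l"
    define i where "i = nat (m - n)"
    have "m = n + int i" "i < 2 * Suc l" "i < Suc l \<longleftrightarrow> c = 2"
      using m by (auto simp: i_def b_def split: if_splits)
    then show "W x m = c" using n[of i] v_run[of i l] c by auto
  qed
qed

end

section \<open>Existence of the construction and conclusion\<close>

definition binary_residue :: "(nat \<Rightarrow> bool) \<Rightarrow> nat \<Rightarrow> int" where
  "binary_residue d k = horner_sum of_bool 2 (map d [0..<k])"

lemma binary_residue_take_bit: "j \<le> k \<Longrightarrow> take_bit j (binary_residue d k) = binary_residue d j"
  by (simp add: binary_residue_def take_bit_horner_sum_bit_eq take_map)

lemma binary_residue_Suc: "binary_residue d (Suc k) mod 2 ^ k = binary_residue d k"
  using binary_residue_take_bit[of k "Suc k" d] by (simp add: take_bit_eq_mod)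

lemma binary_residue_range: "0 \<le> binary_residue d k" "binary_residue d k < 2 ^ k"
  using binary_residue_take_bit[of k k d]
  by (metis order_refl take_bit_nonnegative, metis order_refl take_bit_int_less_exp)

lemma binary_residue_eq_iff:
  assumes "0 \<le> a" "a < 2 ^ k"
  shows "binary_residue d k = a \<longleftrightarrow> (\<forall>i<k. d i = bit a i)"
proof
  assume "binary_residue d k = a"
  then show "\<forall>i<k. d i = bit a i"
    by (auto simp: binary_residue_def bit_horner_sum_bit_iff)
next
  assume "\<forall>i<k. d i = bit a i"
  then have "map d [0..<k] = map (bit a) [0..<k]" by simp
  then have "binary_residue d k = take_bit k a"
    unfolding binary_residue_def by (simp only: horner_sum_bit_eq_take_bit)
  then show "binary_residue d k = a" using assms by (simp add: take_bit_int_eq_self)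
qed

text \<open>A 2-adic integer is encoded as the sequence of its residues, extended to negative indices by truncation.\<close>

theorem dyadic_odometer_exists:
  "\<exists>(M :: (int \<Rightarrow> real) measure) T r. dyadic_odometer M T r"
proof -
  define coin where "coin = uniform_count_measure (UNIV :: bool set)"
  have "prob_space coin" unfolding coin_def by (rule prob_space_uniform_count_measure) auto
  then interpret C: product_prob_space "\<lambda>_. coin" "UNIV :: nat set" by (rule product_prob_spaceI)
  define P where "P = PiM (UNIV :: nat set) (\<lambda>_. coin)"
  interpret P: prob_space P unfolding P_def by (rule C.prob_space_axioms)
  have spP: "space P = UNIV" by (auto simp: P_def space_PiM coin_def space_uniform_count_measure PiE_UNIV_domain)
  have coin_sets: "A \<in> sets coin" for A by (simp add: coin_def sets_uniform_count_measure)
  have P_cyl: "emeasure P {d. \<forall>i<k. d i = bit a i} = ennreal (1 / 2 ^ k)"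
    "{d. \<forall>i<k. d i = bit a i} \<in> sets P" for k and a :: int
  proof -
    have "emeasure P {d \<in> space P. \<forall>i\<in>{..<k}. d i \<in> {bit a i}} = (\<Prod>i<k. emeasure coin {bit a i})"
      unfolding P_def by (rule C.emeasure_PiM_Collect) (auto simp: coin_sets)
    also have "\<dots> = (\<Prod>i<k. ennreal (1 / 2))"
      unfolding coin_def by (subst emeasure_uniform_count_measure) auto
    also have "\<dots> = ennreal (1 / 2 ^ k)" by (subst prod_ennreal) (auto simp: power_one_over)
    finally show "emeasure P {d. \<forall>i<k. d i = bit a i} = ennreal (1 / 2 ^ k)" by (simp add: spP Ball_def)
    have "{d \<in> space P. \<forall>i\<in>{..<k}. d i \<in> {bit a i}} \<in> sets P"
      unfolding P_def
    proof (rule sets.sets_Collect_finite_All)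
      fix i
      have "(\<lambda>d. d i) -` {bit a i} \<inter> space (PiM UNIV (\<lambda>_. coin)) \<in> sets (PiM UNIV (\<lambda>_. coin))"
        by (rule measurable_sets[OF measurable_component_singleton]) (auto simp: coin_sets)
      then show "{d \<in> space (PiM UNIV (\<lambda>_. coin)). d i \<in> {bit a i}} \<in> sets (PiM UNIV (\<lambda>_. coin))"
        by (simp add: vimage_def Int_def conj_commute)
    qed simp
    then show "{d. \<forall>i<k. d i = bit a i} \<in> sets P" by (simp add: spP Ball_def)
  qed
  \<comment> \<open>Coin tosses are read as binary digits, so the law of \<open>X\<close> is Haar
    measure on the 2-adic integers. They are stored as real sequences over the integers to fit the
    carrier type of the final theorem.\<close>
  define X :: "(nat \<Rightarrow> bool) \<Rightarrow> int \<Rightarrow> real" where "X d i = of_int (binary_residue d (nat i))" for d i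
  define S :: "(int \<Rightarrow> real) set" where
    "S = {x. \<exists>y::nat \<Rightarrow> int. (\<forall>k. y (Suc k) mod 2 ^ k = y k) \<and> x = (\<lambda>i. of_int (y (nat i)))}"
  define r :: "nat \<Rightarrow> (int \<Rightarrow> real) \<Rightarrow> int" where "r k x = \<lfloor>x (int k)\<rfloor>" for k x
  define add :: "int \<Rightarrow> (int \<Rightarrow> real) \<Rightarrow> int \<Rightarrow> real" where
    "add m x i = of_int ((r (nat i) x + m) mod 2 ^ nat i)" for m x i
  have r_Suc: "r (Suc k) x mod 2 ^ k = r k x" if x: "x \<in> S" for x k
    using x by (force simp: S_def r_def simp del: of_nat_Suc)
  have r_mod: "r k x mod 2 ^ k = r k x" if "x \<in> S" for x k
    using mod_mod_trivial[of "r (Suc k) x" "2 ^ k"] unfolding r_Suc[OF that] .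
  have S_ext: "x i = of_int (r (nat i) x)" if "x \<in> S" for x i
    using that by (auto simp: S_def r_def)
  have r_add: "r k (add m x) = (r k x + m) mod 2 ^ k" for k m x
    by (simp add: r_def add_def)
  have add_S: "add m x \<in> S" if "x \<in> S" for m x
  proof -
    have "(r (Suc k) x + m) mod 2 ^ Suc k mod 2 ^ k = (r k x + m) mod 2 ^ k" for k
    proof -
      have "(r (Suc k) x + m) mod 2 ^ Suc k mod 2 ^ k = (r (Suc k) x + m) mod 2 ^ k"
        by (rule mod_mod_cancel) simp
      also have "\<dots> = (r (Suc k) x mod 2 ^ k + m) mod 2 ^ k" by (simp only: mod_add_left_eq)
      finally show ?thesis by (simp only: r_Suc[OF that])
    qed
    then show ?thesis unfolding S_def
      by (intro CollectI exI[of _ "\<lambda>k. (r k x + m) mod 2 ^ k"]) (auto simp: add_def)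
  qed
  have add_add: "add (- m) (add m x) = x" if "x \<in> S" for m x
  proof
    fix i
    show "add (- m) (add m x) i = x i"
      unfolding add_def[of "- m"] r_add S_ext[OF that, of i]
      using r_mod[OF that, of "nat i"] by (simp add: mod_diff_left_eq)
  qed
  define G where "G = range (\<lambda>(k, a). {x \<in> S. r k x = a})"
  have GS: "G \<subseteq> Pow S" by (auto simp: G_def)
  have X_S: "X d \<in> S" for d
    unfolding S_def using binary_residue_Suc
    by (intro CollectI exI[of _ "binary_residue d"]) (auto simp: X_def)
  have r_X: "r k (X d) = binary_residue d k" for k d by (simp add: r_def X_def)
  have X_vimage: "{d. binary_residue d k = a} \<in> sets P" for k a
  proof (cases "0 \<le> a \<and> a < 2 ^ k")
    case True
    then show ?thesis using P_cyl(2) by (simp add: binary_residue_eq_iff)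
  next
    case False
    then have "{d. binary_residue d k = a} = {}" 
      using binary_residue_range(1)[of _ k] binary_residue_range(2)[of _ k] by auto
    then show ?thesis by simp
  qed
  have X: "X \<in> measurable P (sigma S G)"
  proof (rule measurable_measure_of[OF GS])
    fix A assume "A \<in> G"
    then obtain k a where "A = {x \<in> S. r k x = a}" by (auto simp: G_def)
    then have "X -` A \<inter> space P = {d. binary_residue d k = a}" using X_S r_X by (auto simp: spP)
    then show "X -` A \<inter> space P \<in> sets P" using X_vimage by simp
  qed (use X_S in auto)
  define M where "M = distr P (sigma S G) X"
  have spM: "space M = S" using GS by (simp add: M_def space_measure_of)
  have setsM: "sets M = sigma_sets S G" using GS by (simp add: M_def sets_measure_of)
  have "dyadic_odometer M (add 1) r"
  proof (rule dyadic_odometer.intro)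
    show "prob_space M" unfolding M_def by (rule P.prob_space_distr[OF X])
    show "dyadic_odometer_axioms M (add 1) r"
    proof
      show "bij_betw (add 1) (space M) (space M)"
        unfolding spM
        by (rule bij_betw_byWitness[where f' = "add (- 1)"])
          (use add_S add_add add_add[of _ "- 1"] in auto)
      show "sets M = sigma_sets (space M) (range (\<lambda>(k, a). {x \<in> space M. r k x = a}))"
        by (simp add: setsM spM G_def)
      fix k :: nat and a :: int assume a: "0 \<le> a" "a < 2 ^ k"
      have "{x \<in> S. r k x = a} \<in> sigma_sets S G" by (rule sigma_sets.Basic) (auto simp: G_def)
      then have "{x \<in> S. r k x = a} \<in> sets (sigma S G)" using GS by (simp add: sets_measure_of)
      then have "measure M {x \<in> S. r k x = a} = measure P (X -` {x \<in> S. r k x = a} \<inter> space P)"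
        unfolding M_def by (rule measure_distr[OF X])
      also have "X -` {x \<in> S. r k x = a} \<inter> space P = {d. \<forall>i<k. d i = bit a i}"
        using X_S r_X binary_residue_eq_iff[OF a] by (auto simp: spP)
      also have "measure P \<dots> = 1 / 2 ^ k" using P_cyl(1)[of k a] by (simp add: measure_def)
      finally show "measure M {x \<in> space M. r k x = a} = 1 / 2 ^ k" by (simp add: spM)
    qed (simp_all add: spM r_add r_Suc)
  qed
  then show ?thesis by blast
qed

text \<open>Nonnegative energies use the run of 2, negative ones the run of -2. The constant 5 in
  place of 4 gives the strict inequality needed for a cover by open balls.\<close>

lemma runs_give_subexponential_energies:
  assumes V: "periodic (2 ^ s) V" "\<And>n. V n \<in> {- 2, 2}" and k: "k > 0"
    and runs: "\<And>n. 0 \<le> n \<Longrightarrow> n < int k \<Longrightarrow> V n = 2"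
      "\<And>n. int k \<le> n \<Longrightarrow> n < int (2 * k) \<Longrightarrow> V n = - 2"
    and len: "2 * k + 2 \<le> 2 ^ s" and e: "e > 0"
  shows "\<exists>N\<ge>n0. \<forall>E\<in>{-4..4}. \<exists>E'. \<bar>E - E'\<bar> < 5 / sqrt k \<and> subexponential_energy V N e E'"
  unfolding subexponential_energy_def
proof (rule uniform_subexponential_energies[where q = "2 ^ s"])
  show per: "periodic (int (2 ^ s)) V" using V(1) by simp
  show "\<bar>V n\<bar> \<le> 2" for n using V(2)[of n] by auto
  fix E :: real assume E: "E \<in> {-4..4}"
  have len': "int (2 * k + 2) \<le> int (2 ^ s)" using len by (simp only: of_nat_le_iff)
  have "\<exists>E' u. \<bar>E - E'\<bar> \<le> 4 / sqrt (of_int (int k)) \<and> periodic (int (2 ^ s)) u \<and> u \<noteq> (\<lambda>_. 0)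
      \<and> (\<forall>n. residual V E' u n = 0)"
  proof (cases "E \<ge> 0")
    case True
    show ?thesis
      by (rule periodic_eigenvalue_of_run[OF per, of 0 "int k" 2 E]) (use runs k len' True E in auto)
  next
    case False
    show ?thesis
      by (rule periodic_eigenvalue_of_run[OF per, of "int k" "int k" "- 2" E]) (use runs k len' False E in auto)
  qed
  moreover have "4 / sqrt k < 5 / sqrt k" using k by (simp add: divide_strict_right_mono)
  ultimately show "\<exists>E' u. \<bar>E - E'\<bar> < 5 / sqrt k \<and> periodic (int (2 ^ s)) u \<and> u \<noteq> (\<lambda>_. 0)
      \<and> (\<forall>n. residual V E' u n = 0)"
    by (auto intro: le_less_trans)
qed (use e in auto)

section \<open>Choice of periods and scales\<close>

definition overwrite :: "nat \<Rightarrow> nat \<Rightarrow> (int \<Rightarrow> real) \<Rightarrow> int \<Rightarrow> real" where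
  "overwrite k s V n = (if n mod 2 ^ s < int k then 2 else if n mod 2 ^ s < int (2 * k) then - 2 else V n)"

theorem run_construction_exists: "\<exists>s v N. run_construction s v N"
proof -
  define P where "P k = (\<lambda>(s :: nat, V :: int \<Rightarrow> real, N :: nat).
    periodic (2 ^ s) V \<and> (\<forall>n. V n \<in> {- 2, 2}) \<and> 2 * 2 ^ s \<le> N \<and>
    (k > 0 \<longrightarrow> (\<forall>E\<in>{-4..4}. \<exists>E'. \<bar>E - E'\<bar> < 5 / sqrt k \<and> subexponential_energy V N (1 / Suc k) E')))" for k
  define Q where "Q k = (\<lambda>(s :: nat, V :: int \<Rightarrow> real, N :: nat) (s', V', N').
    s \<le> s' \<and> N \<le> N' \<and> V' = overwrite (Suc k) s' V \<and> 2 * Suc k * (Suc k * N * 2 ^ Suc k) \<le> 2 ^ s')" for k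
  have "\<exists>f. \<forall>k. P k (f k) \<and> Q k (f k) (f (Suc k))"
  proof (rule dependent_nat_choice)
    \<comment> \<open>A constant potential of period 1; the energy condition is vacuous at stage
      0.\<close>
    have "P 0 (0, \<lambda>_. 2, 2)" by (simp add: P_def periodic_def)
    then show "\<exists>x. P 0 x" ..
    fix x k assume "P k x"
    obtain s V N where x: "x = (s, V, N)" by (cases x)
    then have per: "periodic (2 ^ s) V" and val: "\<And>n. V n \<in> {- 2, 2}" and N: "2 * 2 ^ s \<le> N"
      using \<open>P k x\<close> by (auto simp: P_def)
    \<comment> \<open>This is \<open>overwrite_rare\<close> for \<open>j = m\<close> with
      denominators cleared; an exponent of at least \<open>c\<close> suffices because
      \<open>c < 2 ^ c\<close>.\<close>
    define c where "c = 2 * Suc k * (Suc k * N * 2 ^ Suc k)"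
    define s' where "s' = s + c"
    define V' where "V' = overwrite (Suc k) s' V"
    have c: "c \<le> 2 ^ s'"
    proof -
      have "c < 2 ^ c" by (rule less_exp)
      also have "\<dots> \<le> 2 ^ s'" by (simp add: s'_def)
      finally show ?thesis by simp
    qed
    have "2 * Suc k + 2 \<le> 2 * Suc k * 4" by simp
    also have "\<dots> \<le> c"
    proof -
      have "1 * 2 * 2 \<le> Suc k * N * 2 ^ Suc k"
      proof (intro mult_le_mono)
        have "2 * 1 \<le> 2 * (2::nat) ^ s" by (intro mult_le_mono) auto
        then show "2 \<le> N" using N by linarith
      qed auto
      then show ?thesis unfolding c_def by (intro mult_le_mono) auto
    qed
    finally have len: "2 * Suc k + 2 \<le> 2 ^ s'" using c by linarith
    have per': "periodic (2 ^ s') V'"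
    proof -
      have "periodic (2 ^ s') V" using per by (rule periodic_dvd) (simp add: s'_def le_imp_power_dvd)
      then show ?thesis by (simp add: periodic_def V'_def overwrite_def)
    qed
    have val': "V' n \<in> {- 2, 2}" for n using val by (simp add: V'_def overwrite_def)
    have V'_run: "V' n = (if n < int (Suc k) then 2 else - 2)" if "0 \<le> n" "n < int (2 * Suc k)" for n
    proof -
      have "int (2 * Suc k + 2) \<le> int (2 ^ s')" using len by (simp only: of_nat_le_iff)
      then have "n mod 2 ^ s' = n" using that by (intro mod_pos_pos_trivial) auto
      then show ?thesis using that by (simp add: V'_def overwrite_def)
    qed
    \<comment> \<open>The lower bound keeps the scales increasing and at least two periods long, as
      \<open>N_large\<close> asks.\<close>
    have "\<exists>N'\<ge>max N (2 * 2 ^ s'). \<forall>E\<in>{-4..4}. \<exists>E'. \<bar>E - E'\<bar> < 5 / sqrt (Suc k)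
      \<and> subexponential_energy V' N' (1 / Suc (Suc k)) E'"
    proof (rule runs_give_subexponential_energies[OF per' val'])
      show "V' n = 2" if "0 \<le> n" "n < int (Suc k)" for n using V'_run[of n] that by simp
      show "V' n = - 2" if "int (Suc k) \<le> n" "n < int (2 * Suc k)" for n using V'_run[of n] that by simp
    qed (use len in auto)
    then obtain N' where N': "N' \<ge> max N (2 * 2 ^ s')" and
      en: "\<forall>E\<in>{-4..4}. \<exists>E'. \<bar>E - E'\<bar> < 5 / sqrt (Suc k) \<and> subexponential_energy V' N' (1 / Suc (Suc k)) E'"
      by blast
    have "P (Suc k) (s', V', N')"
      unfolding P_def prod.case
    proof (intro conjI impI allI)
      show "2 * 2 ^ s' \<le> N'" using N' by (rule order_trans[rotated]) simp
      show "\<forall>E\<in>{-4..4}. \<exists>E'. \<bar>E - E'\<bar> < 5 / sqrt (Suc k)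
        \<and> subexponential_energy V' N' (1 / Suc (Suc k)) E'" by (rule en)
    qed (fact per' val')+
    moreover have "Q k x (s', V', N')" using N' c by (simp add: Q_def x V'_def s'_def c_def)
    ultimately show "\<exists>y. P (Suc k) y \<and> Q k x y" by blast
  qed
  then obtain f where "\<forall>k. P k (f k) \<and> Q k (f k) (f (Suc k))" ..
  then have f: "\<And>k. P k (f k)" "\<And>k. Q k (f k) (f (Suc k))" by simp_all
  define s v N where "s k = fst (f k)" and "v k = fst (snd (f k))" and "N k = snd (snd (f k))" for k
  have fk: "f k = (s k, v k, N k)" for k by (simp add: s_def v_def N_def)
  note P' = f(1)[unfolded fk P_def prod.case] and Q' = f(2)[unfolded fk Q_def prod.case]
  have Nmono: "N j \<le> N m" if "j \<le> m" for j m
    by (rule lift_Suc_mono_le[of N, OF _ that]) (use Q' in blast)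
  have "run_construction s v N"
  proof
    fix j m :: nat assume jm: "j \<le> m"
    have "2 * 2 ^ s j \<le> N j" using P' by blast
    then have Nj: "N j > 0" by (metis gr0I le_zero_eq mult_is_0 power_not_zero zero_neq_numeral)
    \<comment> \<open>Monotone scales reduce all earlier \<open>j\<close> to \<open>j = m\<close>,
      the case built into the choice of the period.\<close>
    have "2 * Suc m * (Suc j * N j * 2 ^ Suc m) \<le> 2 * Suc m * (Suc m * N m * 2 ^ Suc m)"
      using jm Nmono[OF jm] by (intro mult_le_mono) auto
    also have "\<dots> \<le> 2 ^ s (Suc m)" using Q' by blast
    finally have "real (2 * Suc m * (Suc j * N j * 2 ^ Suc m)) \<le> real (2 ^ s (Suc m))"
      by (simp only: of_nat_le_iff)
    then have le: "real (2 * Suc m) * (real (Suc j) * real (N j) * 2 ^ Suc m) \<le> 2 ^ s (Suc m)"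
      by (simp only: of_nat_mult of_nat_power of_nat_numeral)
    have pos: "real (Suc j) * real (N j) * 2 ^ Suc m > 0" using Nj by simp
    have "real (2 * Suc m) / 2 ^ s (Suc m) \<le> 1 / (real (Suc j) * real (N j) * 2 ^ Suc m)"
    proof -
      have "A / C \<le> 1 / B" if "A * B \<le> C" "B > 0" "C > 0" for A B C :: real
        using that by (simp add: field_simps)
      from this[OF le pos] show ?thesis by simp
    qed
    also have "\<dots> = (1 / 2) ^ Suc m / (real (N j) * real (Suc j))"
      by (simp add: power_one_over field_simps)
    finally show "real (2 * Suc m) / 2 ^ s (Suc m) \<le> (1 / 2) ^ Suc m / (real (N j) * real (Suc j))" .
  next
    fix k n
    show "v (Suc k) n = (if n mod 2 ^ s (Suc k) < int (Suc k) then 2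
      else if n mod 2 ^ s (Suc k) < int (2 * Suc k) then - 2 else v k n)"
      using Q'[of k] by (simp only: overwrite_def)
    show "periodic (2 ^ s k) (v k)" "v k n \<in> {- 2, 2}" "2 * 2 ^ s k \<le> N k" using P'[of k] by blast+
    show "s k \<le> s (Suc k)" using Q'[of k] by blast
    fix E :: real assume "k > 0" "E \<in> {-4..4}"
    then show "\<exists>E'. \<bar>E - E'\<bar> < 5 / sqrt k \<and> subexponential_energy (v k) (N k) (1 / Suc k) E'"
      using P'[of k] by blast
  qed
  then show ?thesis by blast
qed

text \<open>By periodicity only the phases in one period matter, so the intersection of open
  conditions is finite.\<close>

lemma open_subexponential_energies:
  assumes "periodic q V" "q > 0"
  shows "open {E. subexponential_energy V N e E}"
proof -
  have "{E. subexponential_energy V N e E}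
    = (\<Inter>j\<in>{0..<q}. {E. op_norm (transfer_matrix E (\<lambda>n. V (n + j)) N) < exp (e * real N)})"
  proof (intro equalityI subsetI CollectI)
    fix E assume E: "E \<in> (\<Inter>j\<in>{0..<q}. {E. op_norm (transfer_matrix E (\<lambda>n. V (n + j)) N) < exp (e * real N)})"
    show "subexponential_energy V N e E" unfolding subexponential_energy_def
    proof
      fix j
      have "V (n + j) = V (n + j mod q)" for n
        using periodic_mod[OF assms(1), of "n + j"] periodic_mod[OF assms(1), of "n + j mod q"]
        by (simp add: mod_add_right_eq)
      then have "(\<lambda>n. V (n + j)) = (\<lambda>n. V (n + j mod q))" by (rule ext)
      then show "op_norm (transfer_matrix E (\<lambda>n. V (n + j)) N) < exp (e * real N)"
        using E assms(2) by simp
    qed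
  qed (simp add: subexponential_energy_def)
  also have "open \<dots>" by (intro open_INT ballI open_Collect_less continuous_intros) simp
  finally show ?thesis .
qed

context run_construction
begin

definition good_energies :: "nat \<Rightarrow> real set" where
  "good_energies n = {-4..4} \<inter> (\<Union>k\<in>{n..}. {E. subexponential_energy (v k) (N k) (1 / Suc k) E})"

lemma openin_good_energies: "openin (top_of_set {-4..4}) (good_energies n)"
  unfolding good_energies_def
  by (intro openin_open_Int open_UN ballI open_subexponential_energies[OF v_periodic]) simp

lemma good_energies_dense: "{-4..4} \<subseteq> closure (good_energies n)"
proof
  fix E :: real assume E: "E \<in> {-4..4}"
  show "E \<in> closure (good_energies n)"
    unfolding closure_approachable
  proof (intro allI impI)
    fix e0 :: real assume "e0 > 0"
    define e where "e = min e0 1"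
    have e: "e > 0" "e \<le> e0" "e \<le> 1" using \<open>e0 > 0\<close> by (auto simp: e_def)
    \<comment> \<open>\<open>good_energy\<close> may return an energy outside [-4,4]. Pulling E
      towards 0 by the factor 1 - e / 8 moves it by at most e / 2 and leaves a margin of e / 2 at
      the ends of the interval.\<close>
    define E1 where "E1 = E * (1 - e / 8)"
    have "\<bar>E * (e / 8)\<bar> \<le> 4 * (e / 8)" unfolding abs_mult using E e by (intro mult_mono) auto
    then have 1: "\<bar>E1 - E\<bar> \<le> e / 2" by (simp add: E1_def algebra_simps)
    have "\<bar>E1\<bar> \<le> 4 * (1 - e / 8)" unfolding E1_def abs_mult using E e by (intro mult_mono) auto
    then have 2: "\<bar>E1\<bar> \<le> 4 - e / 2" by simp
    obtain m :: nat where m: "real m > (10 / e)\<^sup>2" using reals_Archimedean2 by blast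
    define k where "k = max (Suc n) m"
    have "k > 0" "k \<ge> n" "real k > (10 / e)\<^sup>2" using m by (auto simp: k_def)
    then have "sqrt k > 10 / e" by (intro real_less_rsqrt)
    then have "5 / sqrt k < e / 2" using e \<open>k > 0\<close> by (simp add: field_simps)
    moreover obtain E' where E': "\<bar>E1 - E'\<bar> < 5 / sqrt k" "subexponential_energy (v k) (N k) (1 / Suc k) E'"
      using good_energy[OF \<open>k > 0\<close>, of E1] 2 e by (auto simp: abs_le_iff)
    ultimately have "\<bar>E1 - E'\<bar> < e / 2" by simp
    then have "- 4 \<le> E'" "E' \<le> 4" "\<bar>E' - E\<bar> < e0" using 1 2 e by linarith+
    then have "E' \<in> {-4..4}" "dist E' E < e0" by (auto simp: dist_real_def)
    then show "\<exists>y\<in>good_energies n. dist y E < e0"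
      using E'(2) \<open>k \<ge> n\<close> by (intro bexI[of _ E']) (auto simp: good_energies_def)
  qed
qed

lemma generic_good_energies:
  "gdelta_in (top_of_set {-4..4}) (\<Inter>n. good_energies n)"
  "top_of_set {-4..4} closure_of (\<Inter>n. good_energies n) = {-4..4}"
proof -
  show "gdelta_in (top_of_set {-4..4}) (\<Inter>n. good_energies n)"
    by (rule gdelta_in_Inter) (auto intro: open_imp_gdelta_in openin_good_energies)
  have "{-4..4} \<subseteq> closure (\<Inter> (range good_energies))"
    by (rule Baire) (use openin_good_energies good_energies_dense in auto)
  moreover have "(\<Inter>n. good_energies n) \<subseteq> {-4..4}" by (auto simp: good_energies_def)
  ultimately show "top_of_set {-4..4} closure_of (\<Inter>n. good_energies n) = {-4..4}"
    by (simp add: closure_of_subtopology Int_absorb1 Int_absorb2)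
qed

end

theorem theorem1p1:
  shows "\<exists>(M :: (int \<Rightarrow> real) measure) (T :: (int \<Rightarrow> real) \<Rightarrow> (int \<Rightarrow> real)) (f :: (int \<Rightarrow> real) \<Rightarrow> real).
    prob_space M \<and> invertible_mpt M T \<and> ergodic M T \<and>
    f \<in> borel_measurable M \<and> bounded (f ` space M) \<and>
    (\<exists>G. gdelta_in (top_of_set {-4..4}) G \<and>
         top_of_set {-4..4} closure_of G = {-4..4} \<and>
         G \<subseteq> {E \<in> {-4..4}. lyapunov M T f E = 0}) \<and>
    (\<forall>\<omega>\<in>space M.
       complex_of_real ` {-4..4} \<subseteq> ell2_spectrum (schroedinger (potential M T f \<omega>)))"
proof -
  obtain M0 :: "(int \<Rightarrow> real) measure" and T r where "dyadic_odometer M0 T r"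
    using dyadic_odometer_exists by blast
  then interpret M0: dyadic_odometer M0 T r .
  obtain s v N where "run_construction s v N" using run_construction_exists by blast
  then interpret C: run_construction s v N .
  interpret R0: run_odometer M0 T r s v N ..
  \<comment> \<open>The points whose orbits show the blocks of all stages; a countable intersection
    of invariant sets of probability one.\<close>
  define \<Omega> where "\<Omega> = (\<Inter>k. R0.contains_runs k)"
  have \<Omega>_sets: "\<Omega> \<in> sets M0" unfolding \<Omega>_def by (rule sets.countable_INT) (auto simp: R0.contains_runs_sets)
  have "AE x in M0. x \<in> R0.contains_runs k" for k
    using R0.prob_contains_runs[of k] M0.AE_in_set_eq_1[OF R0.contains_runs_sets] by simp
  then have "AE x in M0. \<forall>k. x \<in> R0.contains_runs k" by (simp add: AE_all_countable)
  then have "AE x in M0. x \<in> \<Omega>" by (simp add: \<Omega>_def)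
  then have \<Omega>_prob: "M0.prob \<Omega> = 1" using M0.AE_in_set_eq_1[OF \<Omega>_sets] by simp
  have \<Omega>_space: "\<Omega> \<subseteq> space M0" using \<Omega>_sets by (rule sets.sets_into_space)
  have inv: "T x \<in> \<Omega> \<longleftrightarrow> x \<in> \<Omega>" if "x \<in> space M0" for x
    using R0.contains_runs_invariant that unfolding \<Omega>_def by blast
  have "bij_betw T \<Omega> \<Omega>"
  proof (rule bij_betw_subset[OF M0.T_bij \<Omega>_space])
    show "T ` \<Omega> = \<Omega>"
    proof
      show "T ` \<Omega> \<subseteq> \<Omega>" using inv \<Omega>_space by blast
      show "\<Omega> \<subseteq> T ` \<Omega>"
      proof
        fix y assume y: "y \<in> \<Omega>"
        then obtain x where "x \<in> space M0" "y = T x"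
          using M0.T_bij \<Omega>_space by (auto simp: bij_betw_def)
        then show "y \<in> T ` \<Omega>" using inv y by blast
      qed
    qed
  qed
  define M where "M = restrict_space M0 \<Omega>"
  interpret dyadic_odometer M T r
    unfolding M_def by (rule M0.restrict) fact+
  \<comment> \<open>All results now hold for the restricted measure, with the same function
    \<open>W\<close>; the runs at each point come from the definition of \<Omega> in the original
    space.\<close>
  interpret run_odometer M T r s v N ..
  have spM: "space M = \<Omega>" using \<Omega>_space by (auto simp: M_def space_restrict_space)
  show ?thesis
  proof (intro exI conjI ballI)
    show "prob_space M" by (rule prob_space_axioms)
    show "invertible_mpt M T" by (rule invertible_mpt)
    show "ergodic M T" by (rule ergodic)
    show "(\<lambda>x. W x 0) \<in> borel_measurable M" by measurable
    show "bounded ((\<lambda>x. W x 0) ` space M)"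
      by (rule boundedI[of _ 2]) (use abs_limit_potential in auto)
    show "gdelta_in (top_of_set {-4..4}) (\<Inter>n. C.good_energies n)"
      "top_of_set {-4..4} closure_of (\<Inter>n. C.good_energies n) = {-4..4}"
      by (rule C.generic_good_energies)+
    show "(\<Inter>n. C.good_energies n) \<subseteq> {E \<in> {-4..4}. lyapunov M T (\<lambda>x. W x 0) E = 0}"
    proof
      fix E assume "E \<in> (\<Inter>n. C.good_energies n)"
      then have "E \<in> {-4..4}" "\<And>K. \<exists>k\<ge>K. subexponential_energy (v k) (N k) (1 / Suc k) E"
        by (auto simp: C.good_energies_def)
      then show "E \<in> {E \<in> {-4..4}. lyapunov M T (\<lambda>x. W x 0) E = 0}" using lyapunov_zero by blast
    qed
    fix x assume "x \<in> space M"
    then show "complex_of_real ` {-4..4} \<subseteq> ell2_spectrum (schroedinger (potential M T (\<lambda>x. W x 0) x))"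
      using R0.spectrum[of x] by (simp add: potential_eq_W spM \<Omega>_def)
  qed
qed

end
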